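(* Let $TT_3$ be the transitive tournament on 3 vertices. The problem $\Pi'_{TT_3}$ (given an oriented graph $G$, does $G$ contain an induced subdivision of $TT_3$?) is solvable in time $O(n^3)$, where $n$ is the number of vertices of $G$.
   Context: All digraphs are finite and simple (no loops, no parallel arcs). An oriented graph is a digraph with no directed 2-cycle. A subdivision of a digraph $D$ is a digraph obtained from $D$ by replacing each arc $ab$ by a directed $(a,b)$-path of length at least 1, these paths being internally disjoint with new internal vertices. An induced subdivision of $D$ in $G$ is an induced subdigraph of $G$ that is (isomorphic to) a subdivision of $D$. For a fixed digraph $D$, $\Pi'_D$ is the decision problem: Input: an oriented graph $G$. Question: does $G$ contain an induced subdivision of $D$? $TT_3$ has vertices $a,b,c$ and arcs $ab, ac, bc$. *)

theory Defs
  imports "Graph_Theory.Graph_Theory" "HOL-Library.Landau_Symbols"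
begin

section \<open>Induced subdivisions of digraphs\<close>

definition oriented_graph :: "'a pair_pre_digraph \<Rightarrow> bool" where
  "oriented_graph G \<longleftrightarrow>
     pair_digraph G \<and> (\<forall>u v. (u, v) \<in> parcs G \<longrightarrow> (v, u) \<notin> parcs G)"

definition inner_verts :: "'a vwalk \<Rightarrow> 'a set" where
  "inner_verts p = set (butlast (tl p))"

text \<open>
  \<open>subdivision_of D H\<close>: the digraph \<open>H\<close> is, up to isomorphism, a subdivision of \<open>D\<close>. The injection
  \<open>f\<close> places the original vertices, and \<open>P e\<close> is the directed path that replaces the arc \<open>e\<close>.
  The constant \<open>subdivision\<close> of Graph_Theory only concerns bidirected digraphs, where an arc is
  divided together with its reverse, so it does not apply here.
\<close>

definition subdivision_of :: "'a pair_pre_digraph \<Rightarrow> 'b pair_pre_digraph \<Rightarrow> bool" where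
  "subdivision_of D H \<longleftrightarrow> pair_digraph H \<and>
     (\<exists>(f :: 'a \<Rightarrow> 'b) (P :: 'a \<times> 'a \<Rightarrow> 'b vwalk).
        inj_on f (pverts D) \<and>
        (\<forall>e\<in>parcs D. vpath (P e) (with_proj H) \<and> 1 \<le> vwalk_length (P e) \<and>
           hd (P e) = f (fst e) \<and> last (P e) = f (snd e) \<and>
           inner_verts (P e) \<inter> f ` pverts D = {}) \<and>
        (\<forall>e\<in>parcs D. \<forall>e'\<in>parcs D. e \<noteq> e' \<longrightarrow> inner_verts (P e) \<inter> inner_verts (P e') = {}) \<and>
        pverts H = f ` pverts D \<union> (\<Union>e\<in>parcs D. inner_verts (P e)) \<and>
        parcs H = (\<Union>e\<in>parcs D. set (vwalk_arcs (P e))))"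

definition contains_induced_subdivision ::
    "'a pair_pre_digraph \<Rightarrow> 'b pair_pre_digraph \<Rightarrow> bool" where
  "contains_induced_subdivision D G \<longleftrightarrow>
     (\<exists>H. induced_subgraph (with_proj H) (with_proj G) \<and> subdivision_of D H)"

definition TT3 :: "nat pair_pre_digraph" where
  "TT3 = \<lparr> pverts = {0, 1, 2}, parcs = {(0, 1), (0, 2), (1, 2)} \<rparr>"


section \<open>A word RAM\<close>

text \<open>
  The machine model is a unit-cost word RAM in structured form. A program uses finitely many
  registers and finitely many arrays, all holding natural numbers and all initially zero except
  for the input. Every operation and every memory access costs one time unit.
  Each number that occurs during a run, intermediate results and array indices included, has to be
  below a word bound \<open>W\<close>; a run that would exceed the bound is stuck and never terminates.
  Below, \<open>W\<close> is polynomial in the input size, i.e. words have \<open>O(log n)\<close> bits. Without such a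
  bound, unit-cost arithmetic on large numbers would be unreasonably powerful.
\<close>

datatype binop = Add | Sub | Mul | Less | Equal

datatype expr =
    Const nat
  | Reg nat
  | Arr nat expr
  | Op binop expr expr

datatype prog =
    Skip
  | Assign nat expr
  | Store nat expr expr
  | Seq prog prog
  | Cond expr prog prog
  | While expr prog

record state =
  regs :: "nat \<Rightarrow> nat"
  arrs :: "nat \<Rightarrow> nat \<Rightarrow> nat"

fun binop_val :: "binop \<Rightarrow> nat \<Rightarrow> nat \<Rightarrow> nat" where
  "binop_val Add x y = x + y"
| "binop_val Sub x y = x - y"
| "binop_val Mul x y = x * y"
| "binop_val Less x y = (if x < y then 1 else 0)"
| "binop_val Equal x y = (if x = y then 1 else 0)"

fun val :: "expr \<Rightarrow> state \<Rightarrow> nat" where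
  "val (Const c) s = c"
| "val (Reg r) s = regs s r"
| "val (Arr a i) s = arrs s a (val i s)"
| "val (Op b x y) s = binop_val b (val x s) (val y s)"

fun fits :: "nat \<Rightarrow> expr \<Rightarrow> state \<Rightarrow> bool" where
  "fits W (Const c) s \<longleftrightarrow> c < W"
| "fits W (Reg r) s \<longleftrightarrow> regs s r < W"
| "fits W (Arr a i) s \<longleftrightarrow> fits W i s \<and> arrs s a (val i s) < W"
| "fits W (Op b x y) s \<longleftrightarrow> fits W x s \<and> fits W y s \<and> binop_val b (val x s) (val y s) < W"

fun cost :: "expr \<Rightarrow> nat" where
  "cost (Const c) = 1"
| "cost (Reg r) = 1"
| "cost (Arr a i) = 1 + cost i"
| "cost (Op b x y) = 1 + cost x + cost y"

text \<open>
  \<open>run W c s t s'\<close>: started in \<open>s\<close>, the program \<open>c\<close> terminates after \<open>t\<close> time units in \<open>s'\<close>,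
  with all numbers below \<open>W\<close>. A condition counts as true if its value is nonzero.
\<close>

inductive run :: "nat \<Rightarrow> prog \<Rightarrow> state \<Rightarrow> nat \<Rightarrow> state \<Rightarrow> bool" for W where
  Skip: "run W Skip s 1 s"
| Assign: "fits W e s \<Longrightarrow>
    run W (Assign r e) s (1 + cost e) (s\<lparr>regs := (regs s)(r := val e s)\<rparr>)"
| Store: "fits W i s \<Longrightarrow> fits W e s \<Longrightarrow>
    run W (Store a i e) s (1 + cost i + cost e)
      (s\<lparr>arrs := (arrs s)(a := (arrs s a)(val i s := val e s))\<rparr>)"
| Seq: "run W c1 s t1 s' \<Longrightarrow> run W c2 s' t2 s'' \<Longrightarrow> run W (Seq c1 c2) s (t1 + t2) s''"
| Cond_True: "fits W e s \<Longrightarrow> val e s \<noteq> 0 \<Longrightarrow> run W c1 s t s' \<Longrightarrow>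
    run W (Cond e c1 c2) s (1 + cost e + t) s'"
| Cond_False: "fits W e s \<Longrightarrow> val e s = 0 \<Longrightarrow> run W c2 s t s' \<Longrightarrow>
    run W (Cond e c1 c2) s (1 + cost e + t) s'"
| While_True: "fits W e s \<Longrightarrow> val e s \<noteq> 0 \<Longrightarrow> run W c s t1 s' \<Longrightarrow> run W (While e c) s' t2 s'' \<Longrightarrow>
    run W (While e c) s (1 + cost e + t1 + t2) s''"
| While_False: "fits W e s \<Longrightarrow> val e s = 0 \<Longrightarrow> run W (While e c) s (1 + cost e) s"

inductive_cases run_SkipE: "run W Skip s t s'"
inductive_cases run_AssignE: "run W (Assign r e) s t s'"
inductive_cases run_StoreE: "run W (Store a i e) s t s'"
inductive_cases run_SeqE: "run W (Seq c1 c2) s t s'"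
inductive_cases run_CondE: "run W (Cond e c1 c2) s t s'"
inductive_cases run_WhileE: "run W (While e c) s t s'"

lemma run_deterministic:
  "run W c s t s' \<Longrightarrow> run W c s u s'' \<Longrightarrow> t = u \<and> s' = s''"
proof (induction arbitrary: u s'' rule: run.induct)
  case (Skip s)
  then show ?case by (rule run_SkipE) simp
next
  case (Assign e s r)
  from Assign.prems show ?case by (rule run_AssignE) simp
next
  case (Store i s e a)
  from Store.prems show ?case by (rule run_StoreE) simp
next
  case (Seq c1 s t1 s' c2 t2 s2)
  from Seq.prems show ?case
    by (rule run_SeqE) (auto dest!: Seq.IH)
next
  case (Cond_True e s c1 t s' c2)
  from Cond_True.prems show ?case
    by (rule run_CondE) (use Cond_True.hyps in \<open>auto dest!: Cond_True.IH\<close>)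
next
  case (Cond_False e s c2 t s' c1)
  from Cond_False.prems show ?case
    by (rule run_CondE) (use Cond_False.hyps in \<open>auto dest!: Cond_False.IH\<close>)
next
  case (While_True e s c t1 s' t2 s2)
  from While_True.prems show ?case
    by (rule run_WhileE) (use While_True.hyps in \<open>auto dest!: While_True.IH\<close>)
next
  case (While_False e s c)
  from While_False.prems show ?case
    by (rule run_WhileE) (use While_False.hyps in simp_all)
qed


section \<open>Decision problems on digraphs\<close>

text \<open>
  The input is the adjacency matrix of \<open>G\<close> with respect to a listing \<open>vs\<close> of its vertices, stored
  row by row in array 0; register 0 holds the number of vertices.
\<close>

definition input_state :: "'a pair_pre_digraph \<Rightarrow> 'a list \<Rightarrow> state" where
  "input_state G vs = (let n = length vs in
     \<lparr> regs = (\<lambda>r. if r = 0 then n else 0),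
       arrs = (\<lambda>a i. if a = 0 \<and> i < n * n \<and> (vs ! (i div n), vs ! (i mod n)) \<in> parcs G
                     then 1 else 0) \<rparr>)"

text \<open>
  \<open>solvable_in_time I Q f\<close>: some program decides \<open>Q\<close> on all inputs \<open>G\<close> satisfying \<open>I\<close> in time
  \<open>O(f n)\<close>, where \<open>n\<close> is the number of vertices, on words of \<open>k * log 2 (n + 2)\<close> bits for a constant
  \<open>k\<close>. The answer is read from register 0. Runs are deterministic, so the existential
  quantifier over runs speaks about the only possible run. Every finite digraph is isomorphic to
  one on natural numbers, and the listing of the vertices is arbitrary.
\<close>

definition solvable_in_time ::
    "(nat pair_pre_digraph \<Rightarrow> bool) \<Rightarrow> (nat pair_pre_digraph \<Rightarrow> bool) \<Rightarrow> (nat \<Rightarrow> real) \<Rightarrow> bool" where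
  "solvable_in_time I Q f \<longleftrightarrow>
     (\<exists>(c :: prog) (k :: nat) (T :: nat \<Rightarrow> nat).
        (\<lambda>n. real (T n)) \<in> O(f) \<and>
        (\<forall>G vs. I G \<and> distinct vs \<and> set vs = pverts G \<longrightarrow>
           (\<exists>t s. run ((length vs + 2) ^ k) c (input_state G vs) t s \<and>
                  t \<le> T (length vs) \<and> (regs s 0 \<noteq> 0 \<longleftrightarrow> Q G))))"

end

theory Submission
  imports Defs
begin

text \<open>
  A subdivision of \<open>TT\<^sub>3\<close> is a cycle that consists of two directed paths from a source \<open>a\<close> to a sink \<open>c\<close>.
  Call a directed path induced if the only arcs between its vertices are its own. If two induced
  paths leave \<open>a\<close>, share no other vertex and are joined by some further arc, then cutting them at the
  first adjacent pair of vertices gives an induced cycle with one source and one sink. Hence two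
  different induced paths with the same ends force an induced subdivision of \<open>TT\<^sub>3\<close>, and so does an induced path from \<open>a\<close>
  to \<open>v \<noteq> a\<close> with a common out-neighbour of \<open>a\<close> and \<open>v\<close>. Conversely, an induced subdivision of \<open>TT\<^sub>3\<close>
  contains one of these two configurations.

  It therefore suffices to enumerate, for every root \<open>a\<close>, the induced paths that start in \<open>a\<close>, and to
  answer yes as soon as one of the two configurations appears. Every pair \<open>(a, v)\<close> is expanded once,
  in time \<open>O(n)\<close>: the set of vertices adjacent to the path without its last vertex \<open>v\<close>
  arises from the set of the predecessor of \<open>v\<close> by adding the neighbours of that predecessor.
\<close>

section \<open>Induced directed paths and two-block cycles\<close>

text \<open>Equality of the two arc sets demands both that consecutive vertices are joined and that
  there is no chord in either direction.\<close>

definition induced_path :: "'a rel \<Rightarrow> 'a list \<Rightarrow> bool" where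
  "induced_path E p \<longleftrightarrow> p \<noteq> [] \<and> distinct p \<and> E \<inter> set p \<times> set p = set (vwalk_arcs p)"

text \<open>
  The source is \<open>a\<close>, the sink is \<open>c\<close>, and \<open>ps\<close>, \<open>qs\<close> are the inner vertices of the two paths. The vertex
  \<open>b\<close> of \<open>TT\<^sub>3\<close> can be placed on any inner vertex of the first path; \<open>qs = []\<close> stands for the arc \<open>ac\<close>.
\<close>

definition two_block_cycle :: "'a rel \<Rightarrow> 'a \<Rightarrow> 'a list \<Rightarrow> 'a list \<Rightarrow> 'a \<Rightarrow> bool" where
  "two_block_cycle E a ps qs c \<longleftrightarrow> ps \<noteq> [] \<and> distinct (a # ps @ c # qs) \<and>
     (let S = set (a # ps @ c # qs) in
        E \<inter> S \<times> S = set (vwalk_arcs (a # ps @ [c])) \<union> set (vwalk_arcs (a # qs @ [c])))"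

abbreviation adjacent :: "'a rel \<Rightarrow> 'a \<Rightarrow> 'a \<Rightarrow> bool" where
  "adjacent E x y \<equiv> (x, y) \<in> E \<or> (y, x) \<in> E"

section \<open>Arcs of a walk, segments and extensions of induced paths\<close>

lemma vwalk_arcs_subset: "set (vwalk_arcs p) \<subseteq> set p \<times> set p"
  by (induction p rule: vwalk_arcs.induct) auto

lemma set_vwalk_arcs_append:
  "set (vwalk_arcs (p @ q)) = set (vwalk_arcs p) \<union> set (vwalk_arcs q) \<union>
     (if p = [] \<or> q = [] then {} else {(last p, hd q)})"
  by (cases "p = []"; cases "q = []") (auto simp: vwalk_arcs_append)

lemma set_butlast_last: "p \<noteq> [] \<Longrightarrow> set p = insert (last p) (set (butlast p))"
  by (cases p rule: rev_cases) auto

lemma last_notin_butlast: "distinct p \<Longrightarrow> p \<noteq> [] \<Longrightarrow> last p \<notin> set (butlast p)"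
  by (cases p rule: rev_cases) auto

lemma no_arc_from_last:
  assumes "distinct p" "p \<noteq> []"
  shows "(last p, w) \<notin> set (vwalk_arcs p)"
proof -
  have "p = butlast p @ [last p]" using assms by simp
  then have "set (vwalk_arcs p) = set (vwalk_arcs (butlast p @ [last p]))" by simp
  then show ?thesis
    using last_notin_butlast[OF assms] vwalk_arcs_subset[of "butlast p"] last_in_set[of "butlast p"]
    by (cases "butlast p = []") (auto simp: set_vwalk_arcs_append)
qed

text \<open>An arc of \<open>p @ q @ r\<close> other than those of \<open>q\<close> has an end in
  \<open>p\<close> or \<open>r\<close>, so restricting to \<open>set q\<close> leaves the arcs of
  \<open>q\<close> alone.\<close>

lemma induced_path_segment:
  assumes "induced_path E (p @ q @ r)" "q \<noteq> []"
  shows "induced_path E q"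
proof -
  have d: "distinct (p @ q @ r)" and E: "E \<inter> set (p @ q @ r) \<times> set (p @ q @ r) = set (vwalk_arcs (p @ q @ r))"
    using assms by (auto simp: induced_path_def)
  have "E \<inter> set q \<times> set q = set (vwalk_arcs (p @ q @ r)) \<inter> set q \<times> set q"
    unfolding E[symmetric] by auto
  also have "\<dots> = set (vwalk_arcs q)"
  proof -
    have "p = [] \<or> last p \<notin> set q" "r = [] \<or> hd r \<notin> set q"
      using d by (cases p rule: rev_cases; auto) (use d in \<open>cases r; auto\<close>)
    moreover have "set (vwalk_arcs p) \<inter> set q \<times> set q = {}" "set (vwalk_arcs r) \<inter> set q \<times> set q = {}"
      using d vwalk_arcs_subset[of p] vwalk_arcs_subset[of r] by auto
    ultimately show ?thesis
      using vwalk_arcs_subset[of q] assms(2) by (auto simp: set_vwalk_arcs_append split: if_splits)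
  qed
  finally show ?thesis using d assms(2) by (simp add: induced_path_def)
qed

text \<open>The rule by which the search extends a path. If \<open>w\<close> were on
  \<open>p\<close>, the arc from \<open>last p\<close> to \<open>w\<close> would be an arc of the
  path that leaves its final vertex.\<close>

lemma induced_path_snoc:
  assumes "induced_path E p" "(last p, w) \<in> E" "(w, last p) \<notin> E" "(w, w) \<notin> E"
    and "\<forall>x\<in>set (butlast p). \<not> adjacent E x w"
  shows "induced_path E (p @ [w])"
proof -
  have ne: "p \<noteq> []" and d: "distinct p" and E: "E \<inter> set p \<times> set p = set (vwalk_arcs p)"
    using assms by (auto simp: induced_path_def)
  have p: "set p = insert (last p) (set (butlast p))"
    using ne by (rule set_butlast_last)
  have w: "w \<notin> set p"
  proof
    assume "w \<in> set p"
    then have "(last p, w) \<in> E \<inter> set p \<times> set p" using ne assms(2) by simp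
    then have "(last p, w) \<in> set (vwalk_arcs p)" unfolding E .
    then show False using no_arc_from_last[OF d ne] by blast
  qed
  have "E \<inter> set (p @ [w]) \<times> set (p @ [w]) = insert (last p, w) (E \<inter> set p \<times> set p)"
    using assms p by auto
  then show ?thesis using w d ne E by (simp add: induced_path_def set_vwalk_arcs_append)
qed

lemma induced_path_snocD:
  assumes "induced_path E (p @ [w])" "p \<noteq> []"
  shows "(last p, w) \<in> E" "x \<in> set (butlast p) \<Longrightarrow> \<not> adjacent E x w"
proof -
  have d: "distinct (p @ [w])" and E: "E \<inter> set (p @ [w]) \<times> set (p @ [w]) = set (vwalk_arcs (p @ [w]))"
    using assms by (auto simp: induced_path_def)
  show "(last p, w) \<in> E" using E assms(2) by (auto simp: set_vwalk_arcs_append)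
  assume x: "x \<in> set (butlast p)"
  then have xp: "x \<in> set p" by (rule in_set_butlastD)
  have "x \<noteq> last p" using x d assms(2) last_notin_butlast[of p] by auto
  show "\<not> adjacent E x w"
  proof
    assume "adjacent E x w"
    then have "(x, w) \<in> set (vwalk_arcs (p @ [w])) \<or> (w, x) \<in> set (vwalk_arcs (p @ [w]))"
      using E[symmetric] xp by auto
    then show False using d \<open>x \<noteq> last p\<close> xp vwalk_arcs_subset[of p]
      by (auto simp: set_vwalk_arcs_append split: if_splits)
  qed
qed

section \<open>Configurations that force a two-block cycle\<close>

text \<open>Let \<open>x\<close> be the first vertex of \<open>ps\<close> with a neighbour in
  \<open>qs\<close>, and \<open>y\<close> its first neighbour there. Apart from the common start
  \<open>a\<close>, the prefixes up to \<open>x\<close> and \<open>y\<close> are joined only by the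
  arc between \<open>x\<close> and \<open>y\<close>, whose head becomes the sink.\<close>

lemma two_block_cycle_cross_arc:
  assumes asym: "asym E"
    and P: "induced_path E (a # ps)" and Q: "induced_path E (a # qs)"
    and disj: "set ps \<inter> set qs = {}"
    and cross: "x \<in> set ps" "y \<in> set qs" "adjacent E x y"
  shows "\<exists>a ps qs c. two_block_cycle E a ps qs c"
proof -
  have "\<exists>u\<in>set ps. \<exists>y\<in>set qs. adjacent E u y" using cross by blast
  from split_list_first_prop[OF this]
  obtain ps1 x ps2 where ps: "ps = ps1 @ x # ps2" "\<exists>y\<in>set qs. adjacent E x y"
    "\<forall>u\<in>set ps1. \<forall>y\<in>set qs. \<not> adjacent E u y" by blast
  from split_list_first_prop[OF ps(2)]
  obtain qs1 y qs2 where qs: "qs = qs1 @ y # qs2" "adjacent E x y"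
    "\<forall>y\<in>set qs1. \<not> adjacent E x y" by blast
  have P': "induced_path E (a # ps1 @ [x])"
    using induced_path_segment[of E "[]" "a # ps1 @ [x]" ps2] P ps by simp
  have Q': "induced_path E (a # qs1 @ [y])"
    using induced_path_segment[of E "[]" "a # qs1 @ [y]" qs2] Q qs by simp
  define A where "A = set (a # ps1 @ [x])"
  define B where "B = set (a # qs1 @ [y])"
  have EA: "E \<inter> A \<times> A = set (vwalk_arcs (a # ps1 @ [x]))"
    and EB: "E \<inter> B \<times> B = set (vwalk_arcs (a # qs1 @ [y]))"
    and dA: "distinct (a # ps1 @ [x])" and dB: "distinct (a # qs1 @ [y])"
    using P' Q' by (auto simp: induced_path_def A_def B_def)
  have d: "distinct (a # (ps1 @ [x]) @ y # qs1)" "distinct (a # (qs1 @ [y]) @ x # ps1)"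
    using dA dB disj ps(1) qs(1) by auto
  have S: "E \<inter> (A \<union> B) \<times> (A \<union> B) = E \<inter> A \<times> A \<union> E \<inter> B \<times> B \<union> (E \<inter> {(x, y), (y, x)})"
  proof -
    have "x' = a \<or> y' = a \<or> x' = x \<and> y' = y"
      if "x' \<in> A" "y' \<in> B" "adjacent E x' y'" for x' y'
      using that ps(3) qs(1,3) unfolding A_def B_def by (auto 4 3)
    moreover have "x \<in> A" "y \<in> B" "a \<in> A" "a \<in> B" by (simp_all add: A_def B_def)
    ultimately show ?thesis by blast
  qed
  consider "(x, y) \<in> E" "(y, x) \<notin> E" | "(y, x) \<in> E" "(x, y) \<notin> E"
    using qs(2) asymD[OF asym] by blast
  then show ?thesis
  proof cases
    case 1
    then have "E \<inter> {(x, y), (y, x)} = {(x, y)}" by auto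
    moreover have "set (a # (ps1 @ [x]) @ y # qs1) = A \<union> B" by (auto simp: A_def B_def)
    moreover have "set (vwalk_arcs (a # (ps1 @ [x]) @ [y])) = insert (x, y) (set (vwalk_arcs (a # ps1 @ [x])))"
      using set_vwalk_arcs_append[of "a # ps1 @ [x]" "[y]"] by simp
    ultimately have "two_block_cycle E a (ps1 @ [x]) qs1 y"
      unfolding two_block_cycle_def Let_def using d(1) S EA EB by (simp add: Un_commute insert_commute)
    then show ?thesis by blast
  next
    case 2
    then have "E \<inter> {(x, y), (y, x)} = {(y, x)}" by auto
    moreover have "set (a # (qs1 @ [y]) @ x # ps1) = A \<union> B" by (auto simp: A_def B_def)
    moreover have "set (vwalk_arcs (a # (qs1 @ [y]) @ [x])) = insert (y, x) (set (vwalk_arcs (a # qs1 @ [y])))"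
      using set_vwalk_arcs_append[of "a # qs1 @ [y]" "[x]"] by simp
    ultimately have "two_block_cycle E a (qs1 @ [y]) ps1 x"
      unfolding two_block_cycle_def Let_def using d(2) S EA EB by (simp add: Un_commute insert_commute)
    then show ?thesis by blast
  qed
qed

text \<open>The path \<open>p\<close> and the two-vertex path from \<open>hd p\<close> to
  \<open>w\<close> share only their start, and the arc from \<open>last p\<close> to
  \<open>w\<close> is a cross arc between them.\<close>

lemma two_block_cycle_shortcut:
  assumes asym: "asym E"
    and P: "induced_path E p" and "hd p \<noteq> last p"
    and arcs: "(last p, w) \<in> E" "(hd p, w) \<in> E"
  shows "\<exists>a ps qs c. two_block_cycle E a ps qs c"
proof -
  obtain a ps where p: "p = a # ps" using P by (cases p) (auto simp: induced_path_def)
  with assms(3) have ps: "ps \<noteq> []" "last p = last ps" by auto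
  have "w \<notin> set p"
  proof
    have d: "distinct p" and E: "E \<inter> set p \<times> set p = set (vwalk_arcs p)"
      using P by (auto simp: induced_path_def)
    assume "w \<in> set p"
    then have "(last p, w) \<in> E \<inter> set p \<times> set p" using arcs p last_in_set[of p] by blast
    then have "(last p, w) \<in> set (vwalk_arcs p)" unfolding E .
    then show False using no_arc_from_last[OF d] p by blast
  qed
  moreover have "induced_path E [a, w]"
    using arcs(2) asymD[OF asym arcs(2)] p \<open>w \<notin> set p\<close> asym
    by (auto simp: induced_path_def dest: asymD)
  ultimately show ?thesis
    using two_block_cycle_cross_arc[OF asym, of a ps "[w]" "last ps" w] P p ps arcs by auto
qed

text \<open>After the longest common prefix, which ends in \<open>a\<close>, the paths diverge.
  Following the second one to its first vertex \<open>c\<close> on the first one leaves a disjoint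
  part \<open>q2\<close> before \<open>c\<close>, and the arc from \<open>last q2\<close> to
  \<open>c\<close> is a cross arc.\<close>

lemma two_block_cycle_two_paths:
  assumes asym: "asym E"
    and P: "induced_path E p" and Q: "induced_path E q"
    and "hd p = hd q" "last p = last q" "p \<noteq> q"
  shows "\<exists>a ps qs c. two_block_cycle E a ps qs c"
proof -
  have ne: "p \<noteq> []" "q \<noteq> []" and d: "distinct p" "distinct q"
    using P Q by (auto simp: induced_path_def)
  \<comment> \<open>A proper prefix of a distinct list cannot have the same last element, so neither
    path is a prefix of the other.\<close>
  have np: "r = []" if "s @ r = t" "last s = last t" "s \<noteq> []" "distinct t" for s r t :: "'a list"
  proof (rule ccontr)
    assume "r \<noteq> []"
    then have "last s \<in> set s \<inter> set r" using that by (metis IntI last_appendR last_in_set)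
    then show False using that by auto
  qed
  obtain l p1 q1 where l: "p = l @ p1" "q = l @ q1" "p1 = [] \<or> q1 = [] \<or> hd p1 \<noteq> hd q1"
    using longest_common_prefix[of p q] by metis
  have "p1 \<noteq> []" "q1 \<noteq> []"
    using np[of p q1 q] np[of q p1 p] l assms(4-6) ne d by auto
  then have hd: "hd p1 \<noteq> hd q1" using l by blast
  have "l \<noteq> []" using hd l assms(4) by auto
  then obtain l' a where l': "l = l' @ [a]" by (metis rev_exhaust)
  have P1: "induced_path E (a # p1)"
    using induced_path_segment[of E l' "a # p1" "[]"] P l l' by simp
  have Q1: "induced_path E (a # q1)"
    using induced_path_segment[of E l' "a # q1" "[]"] Q l l' by simp
  have "last p1 = last q1" using assms(5) l \<open>p1 \<noteq> []\<close> \<open>q1 \<noteq> []\<close> by simp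
  then have "\<exists>c\<in>set q1. c \<in> set p1" using \<open>p1 \<noteq> []\<close> \<open>q1 \<noteq> []\<close> by (metis last_in_set)
  from split_list_first_prop[OF this]
  obtain q2 c q3 where q1: "q1 = q2 @ c # q3" "c \<in> set p1" "\<forall>y\<in>set q2. y \<notin> set p1"
    by blast
  have Q2: "induced_path E (a # q2 @ [c])"
    using induced_path_segment[of E "[]" "a # q2 @ [c]" q3] Q1 q1 by simp
  have c: "(last (a # q2), c) \<in> E" using induced_path_snocD(1)[of E "a # q2" c] Q2 by simp
  \<comment> \<open>Otherwise \<open>a\<close> has an arc to the vertex \<open>c\<close> of the
    first path, which makes \<open>c\<close> the successor of \<open>a\<close> on both
    paths.\<close>
  have "q2 \<noteq> []"
  proof
    assume "q2 = []"
    with c have "(a, c) \<in> E" by simp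
    then have "(a, c) \<in> set (vwalk_arcs (a # p1))"
      using P1 q1(2) by (auto simp: induced_path_def)
    then have "c = hd p1" using P1 \<open>p1 \<noteq> []\<close> vwalk_arcs_subset[of p1]
      by (auto simp: induced_path_def)
    then show False using hd q1 \<open>q2 = []\<close> by simp
  qed
  moreover have "induced_path E (a # q2)"
    using induced_path_segment[of E "[]" "a # q2" "[c]"] Q2 by simp
  ultimately show ?thesis
    using two_block_cycle_cross_arc[OF asym P1, of q2 c "last q2"] q1 c
    by (metis disjoint_iff last.simps last_in_set)
qed

text \<open>The two configurations of the search, read off from a cycle. When \<open>qs\<close> is
  empty, the arc from \<open>a\<close> to \<open>c\<close> is a chord of
  \<open>a # ps @ [c]\<close>, so the induced path has to stop before \<open>c\<close>.\<close>

lemma two_block_cycle_paths: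
  assumes "two_block_cycle E a ps qs c"
  shows "induced_path E (a # ps)" "(last ps, c) \<in> E"
    and "qs = [] \<Longrightarrow> (a, c) \<in> E"
    and "qs \<noteq> [] \<Longrightarrow> induced_path E (a # ps @ [c])"
    and "qs \<noteq> [] \<Longrightarrow> induced_path E (a # qs @ [c])"
proof -
  define S where "S = set (a # ps @ c # qs)"
  define P where "P = set (vwalk_arcs (a # ps @ [c]))"
  define Q where "Q = set (vwalk_arcs (a # qs @ [c]))"
  have ne: "ps \<noteq> []" and d: "distinct (a # ps @ c # qs)" and E: "E \<inter> S \<times> S = P \<union> Q"
    using assms by (auto simp: two_block_cycle_def S_def P_def Q_def Let_def)
  have P: "P = set (vwalk_arcs (a # ps)) \<union> {(last ps, c)}"
    using ne set_vwalk_arcs_append[of "a # ps" "[c]"] by (simp add: P_def)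
  have Q: "Q = set (vwalk_arcs (a # qs)) \<union> {(last (a # qs), c)}"
    using set_vwalk_arcs_append[of "a # qs" "[c]"] by (simp add: Q_def)
  show "(last ps, c) \<in> E" using E P by auto
  show "(a, c) \<in> E" if "qs = []" using E Q that by auto
  have T: "E \<inter> T \<times> T = (P \<inter> T \<times> T) \<union> (Q \<inter> T \<times> T)" if "T \<subseteq> S" for T
    using E that by auto
  \<comment> \<open>Each arc of a side with inner vertices has an inner vertex as an end, hence does
    not run between vertices of the other side.\<close>
  have meet: "set (vwalk_arcs (a # p @ [c])) \<inter> set (a # q @ [c]) \<times> set (a # q @ [c]) = {}"
    if "p \<noteq> []" "distinct (a # p @ c # q)" for p q
  proof -
    have N: "x \<notin> set (a # q @ [c])" if "x \<in> set p" for x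
      using that \<open>distinct (a # p @ c # q)\<close> by auto
    have "hd p \<in> set p" "last p \<in> set p" using that by auto
    moreover have "set (vwalk_arcs (a # p @ [c])) = {(a, hd p), (last p, c)} \<union> set (vwalk_arcs p)"
      using that by (simp add: set_vwalk_arcs_append insert_commute)
    ultimately have *: "fst e \<in> set p \<or> snd e \<in> set p" if "e \<in> set (vwalk_arcs (a # p @ [c]))" for e
      using that vwalk_arcs_subset[of p] by (cases e) auto
    show ?thesis
    proof (rule equals0I)
      fix e assume "e \<in> set (vwalk_arcs (a # p @ [c])) \<inter> set (a # q @ [c]) \<times> set (a # q @ [c])"
      then have "fst e \<in> set p \<or> snd e \<in> set p" "fst e \<in> set (a # q @ [c])" "snd e \<in> set (a # q @ [c])"
        using * by (simp_all only: Int_iff mem_Times_iff)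
      then show False using N by blast
    qed
  qed
  have meetQ: "Q \<inter> set (a # ps @ [c]) \<times> set (a # ps @ [c]) = {}" if "qs \<noteq> []"
  proof -
    have "distinct (a # qs @ c # ps)" using d by auto
    then show ?thesis unfolding Q_def by (rule meet[OF that])
  qed
  have meetP: "P \<inter> set (a # qs @ [c]) \<times> set (a # qs @ [c]) = {}"
    unfolding P_def by (rule meet[OF ne d])
  have PP: "P \<subseteq> set (a # ps @ [c]) \<times> set (a # ps @ [c])"
    and QQ: "Q \<subseteq> set (a # qs @ [c]) \<times> set (a # qs @ [c])"
    unfolding P_def Q_def by (rule vwalk_arcs_subset)+
  have S: "set (a # ps) \<subseteq> S" "set (a # ps @ [c]) \<subseteq> S" "set (a # qs @ [c]) \<subseteq> S"
    unfolding S_def by auto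
  show "induced_path E (a # ps)"
  proof -
    have "c \<notin> set (a # ps)" using d by auto
    have "P \<inter> set (a # ps) \<times> set (a # ps) = set (vwalk_arcs (a # ps))"
    proof -
      have "(A \<union> {e}) \<inter> B = A" if "A \<subseteq> B" "e \<notin> B" for A B :: "'a rel" and e
        using that by auto
      moreover have "(last ps, c) \<notin> set (a # ps) \<times> set (a # ps)" using \<open>c \<notin> _\<close> by blast
      ultimately show ?thesis unfolding P using vwalk_arcs_subset by metis
    qed
    moreover have "Q \<inter> set (a # ps) \<times> set (a # ps) = {}"
    proof (cases "qs = []")
      case True
      then have "Q = {(a, c)}" using Q by simp
      then show ?thesis using \<open>c \<notin> _\<close> by blast
    next
      case False
      have "set (a # ps) \<subseteq> set (a # ps @ [c])" by auto
      then show ?thesis using meetQ[OF False] by blast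
    qed
    ultimately have "E \<inter> set (a # ps) \<times> set (a # ps) = set (vwalk_arcs (a # ps))"
      using T[OF S(1)] by (simp only: Un_empty_right)
    then show ?thesis using d by (auto simp: induced_path_def)
  qed
  show "induced_path E (a # ps @ [c])" if "qs \<noteq> []"
  proof -
    have "E \<inter> set (a # ps @ [c]) \<times> set (a # ps @ [c]) = P"
      using T[of "set (a # ps @ [c])"] S meetQ[OF that] PP by blast
    then show ?thesis using d by (auto simp: induced_path_def P_def)
  qed
  show "induced_path E (a # qs @ [c])" if "qs \<noteq> []"
  proof -
    have "E \<inter> set (a # qs @ [c]) \<times> set (a # qs @ [c]) = Q"
      using T[of "set (a # qs @ [c])"] S meetP QQ by blast
    then show ?thesis using d by (auto simp: induced_path_def Q_def)
  qed
qed

section \<open>Induced subdivisions of the transitive triangle\<close>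

lemma vwalk_endpoints_decomp:
  assumes "1 \<le> vwalk_length p"
  obtains xs where "p = hd p # xs @ [last p]" "inner_verts p = set xs"
proof -
  from assms obtain u q where p: "p = u # q" "q \<noteq> []"
    by (cases p; cases "tl p") auto
  then have "p = hd p # butlast q @ [last p]" "inner_verts p = set (butlast q)"
    by (auto simp: inner_verts_def)
  then show thesis by (rule that)
qed

lemma inner_verts_endpoints [simp]: "inner_verts (u # xs @ [v]) = set xs"
  by (simp add: inner_verts_def)

text \<open>The paths that replace the arcs 01 and 12 join at the image of 1 to form one side of the
  cycle; the path for 02 is the other side.\<close>

lemma TT3_induced_subdivision_imp_two_block_cycle:
  assumes "contains_induced_subdivision TT3 G"
  shows "\<exists>a ps qs c. two_block_cycle (parcs G) a ps qs c"
proof -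
  from assms obtain H where ind: "induced_subgraph (with_proj H) (with_proj G)"
    and sub: "subdivision_of TT3 H"
    by (auto simp: contains_induced_subdivision_def)
  from sub obtain f P where inj: "inj_on f {0, 1, 2 :: nat}"
    and paths: "\<forall>e\<in>{(0, 1), (0, 2), (1, 2)}. vpath (P e) (with_proj H) \<and> 1 \<le> vwalk_length (P e) \<and>
           hd (P e) = f (fst e) \<and> last (P e) = f (snd e) \<and> inner_verts (P e) \<inter> f ` {0, 1, 2} = {}"
    and disj: "\<forall>e\<in>{(0, 1), (0, 2), (1, 2)}. \<forall>e'\<in>{(0, 1), (0, 2), (1, 2)}.
           e \<noteq> e' \<longrightarrow> inner_verts (P e) \<inter> inner_verts (P e') = {}"
    and V: "pverts H = f ` {0, 1, 2} \<union> (\<Union>e\<in>{(0, 1), (0, 2), (1, 2)}. inner_verts (P e))"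
    and A: "parcs H = (\<Union>e\<in>{(0, 1), (0, 2), (1, 2)}. set (vwalk_arcs (P e)))"
    unfolding subdivision_of_def TT3_def pair_pre_digraph.simps by (elim exE conjE) blast
  define a b c where "a = f 0" and "b = f 1" and "c = f 2"
  have abc: "a \<noteq> b" "a \<noteq> c" "b \<noteq> c" "f ` {0, 1, 2} = {a, b, c}"
    using inj by (auto simp: a_def b_def c_def)
  have p: "vpath (P (0, 1)) (with_proj H)" "1 \<le> vwalk_length (P (0, 1))"
      "hd (P (0, 1)) = a" "last (P (0, 1)) = b" "inner_verts (P (0, 1)) \<inter> {a, b, c} = {}"
      "vpath (P (0, 2)) (with_proj H)" "1 \<le> vwalk_length (P (0, 2))"
      "hd (P (0, 2)) = a" "last (P (0, 2)) = c" "inner_verts (P (0, 2)) \<inter> {a, b, c} = {}"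
      "vpath (P (1, 2)) (with_proj H)" "1 \<le> vwalk_length (P (1, 2))"
      "hd (P (1, 2)) = b" "last (P (1, 2)) = c" "inner_verts (P (1, 2)) \<inter> {a, b, c} = {}"
    using paths unfolding abc(4) by (simp_all add: a_def b_def c_def)
  obtain x where x: "P (0, 1) = a # x @ [b]"
    by (rule vwalk_endpoints_decomp[OF p(2)]) (simp only: p)
  obtain y where y: "P (0, 2) = a # y @ [c]"
    by (rule vwalk_endpoints_decomp[OF p(7)]) (simp only: p)
  obtain z where z: "P (1, 2) = b # z @ [c]"
    by (rule vwalk_endpoints_decomp[OF p(12)]) (simp only: p)
  have d: "distinct (a # x @ [b])" "distinct (a # y @ [c])" "distinct (b # z @ [c])"
    using p(1,6,11) unfolding x y z vpath_def by blast+
  have dd: "set x \<inter> set y = {}" "set x \<inter> set z = {}" "set y \<inter> set z = {}"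
    using disj by (simp_all add: x y z del: One_nat_def)
  have i: "set x \<inter> {a, b, c} = {}" "set y \<inter> {a, b, c} = {}" "set z \<inter> {a, b, c} = {}"
    using p(5,10,15) by (simp_all add: x y z del: One_nat_def)
  define ps where "ps = x @ b # z"
  have V': "pverts H = set (a # ps @ c # y)"
    unfolding V abc(4) by (auto simp: x y z ps_def simp del: One_nat_def)
  have "parcs H = set (vwalk_arcs (a # x @ [b])) \<union> set (vwalk_arcs (b # z @ [c])) \<union> set (vwalk_arcs (a # y @ [c]))"
    unfolding A by (simp only: UN_insert UN_empty Un_empty_right Un_empty_left Un_ac x y z)
  also have "set (vwalk_arcs (a # x @ [b])) \<union> set (vwalk_arcs (b # z @ [c])) = set (vwalk_arcs (a # ps @ [c]))"
    using set_vwalk_arcs_append[of "a # x" "[b]"] set_vwalk_arcs_append[of "a # x" "b # z @ [c]"]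
    by (simp add: ps_def insert_commute)
  finally have A': "parcs H = set (vwalk_arcs (a # ps @ [c])) \<union> set (vwalk_arcs (a # y @ [c]))" .
  have "parcs G \<inter> pverts H \<times> pverts H = parcs H"
    using ind unfolding induced_subgraph_def with_proj_simps by fastforce
  moreover have "distinct (a # ps @ c # y)"
    using d dd i abc by (auto simp: ps_def)
  ultimately have "two_block_cycle (parcs G) a ps y c"
    unfolding two_block_cycle_def Let_def V'[symmetric] A'[symmetric] by (simp add: ps_def)
  then show ?thesis by blast
qed

text \<open>Vertex 1 of \<open>TT3\<close> goes to the first inner vertex \<open>b\<close> of
  \<open>ps\<close>, so that the arc 01 stays undivided and the rest of \<open>ps\<close> subdivides
  the arc 12.\<close>

lemma two_block_cycle_imp_TT3_induced_subdivision:
  assumes G: "pair_digraph G" and tb: "two_block_cycle (parcs G) a ps qs c"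
  shows "contains_induced_subdivision TT3 G"
proof -
  interpret G: pair_digraph G by (rule G)
  obtain b xs where ps: "ps = b # xs"
    using tb by (cases ps) (auto simp: two_block_cycle_def)
  define S where "S = set (a # ps @ c # qs)"
  have d: "distinct (a # ps @ c # qs)"
    and E: "parcs G \<inter> S \<times> S = set (vwalk_arcs (a # ps @ [c])) \<union> set (vwalk_arcs (a # qs @ [c]))"
    using tb by (auto simp: two_block_cycle_def S_def Let_def)
  define H where "H = \<lparr> pverts = S, parcs = parcs G \<inter> S \<times> S \<rparr>"
  have arcs: "set (vwalk_arcs (a # ps @ [c])) = set (vwalk_arcs [a, b]) \<union> set (vwalk_arcs (b # xs @ [c]))"
    by (simp add: ps insert_commute)
  \<comment> \<open>A two-block cycle refers to the arc relation alone; its vertices belong to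
    \<open>G\<close> because each of them is an end of an arc.\<close>
  have SV: "S \<subseteq> pverts G"
  proof
    fix v assume v: "v \<in> S"
    have cover: "set (u # xs @ [w]) \<subseteq> fst ` set (vwalk_arcs (u # xs @ [w])) \<union> snd ` set (vwalk_arcs (u # xs @ [w]))"
      for u w :: 'a and xs
    proof (induction xs arbitrary: u)
      case (Cons x xs)
      then show ?case by (simp del: vwalk_arcs_Cons) blast
    qed simp
    have "v \<in> set (a # ps @ [c]) \<or> v \<in> set (a # qs @ [c])" using v by (auto simp: S_def)
    then have "v \<in> fst ` (parcs G \<inter> S \<times> S) \<union> snd ` (parcs G \<inter> S \<times> S)"
      using cover[of a ps c] cover[of a qs c] unfolding E image_Un by blast
    then show "v \<in> pverts G" using G.in_arcsD1 G.in_arcsD2 by auto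
  qed
  have H: "pair_digraph H"
    using finite_subset[OF SV G.pair_finite_verts] G.pair_finite_arcs G.no_loops'
    by unfold_locales (auto simp: H_def)
  moreover have "induced_subgraph (with_proj H) (with_proj G)"
  proof -
    interpret H: pair_digraph H by (rule H)
    show ?thesis
      using SV G.wf_digraph_axioms H.wf_digraph_axioms
      by (auto simp: induced_subgraph_def subgraph_def compatibleI_with_proj H_def)
  qed
  moreover have "subdivision_of TT3 H"
  proof -
    define f :: "nat \<Rightarrow> 'a" where "f i = (if i = 0 then a else if i = 1 then b else c)" for i
    define P :: "nat \<times> nat \<Rightarrow> 'a list" where
      "P e = (if e = (0, 1) then a # [] @ [b] else if e = (1, 2) then b # xs @ [c] else a # qs @ [c])" for e
    have f: "f 0 = a" "f 1 = b" "f 2 = c" by (simp_all add: f_def)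
    have P: "P (0, 1) = a # [] @ [b]" "P (1, 2) = b # xs @ [c]" "P (0, 2) = a # qs @ [c]"
      by (simp_all add: P_def)
    have v: "vpath (P (0, 1)) (with_proj H)" "vpath (P (1, 2)) (with_proj H)" "vpath (P (0, 2)) (with_proj H)"
      unfolding P vpath_def vwalk_def using d E arcs
      by (simp_all only: H_def with_proj_simps pair_pre_digraph.simps) (auto simp: S_def ps)
    show ?thesis
      unfolding subdivision_of_def TT3_def pair_pre_digraph.simps
    proof (intro conjI exI[of _ f] exI[of _ P] H)
      show "inj_on f {0, 1, 2}" using d by (auto simp: f ps simp del: One_nat_def)
      show "\<forall>e\<in>{(0, 1), (0, 2), (1, 2)}. vpath (P e) (with_proj H) \<and> 1 \<le> vwalk_length (P e) \<and>
           hd (P e) = f (fst e) \<and> last (P e) = f (snd e) \<and> inner_verts (P e) \<inter> f ` {0, 1, 2} = {}"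
        using v d by (simp add: P f ps inner_verts_endpoints[of a "[]" b, simplified] del: One_nat_def)
      show "\<forall>e\<in>{(0, 1), (0, 2), (1, 2)}. \<forall>e'\<in>{(0, 1), (0, 2), (1, 2)}.
           e \<noteq> e' \<longrightarrow> inner_verts (P e) \<inter> inner_verts (P e') = {}"
        using d by (auto simp: P ps inner_verts_endpoints[of a "[]" b, simplified] simp del: One_nat_def)
      show "pverts H = f ` {0, 1, 2} \<union> (\<Union>e\<in>{(0, 1), (0, 2), (1, 2)}. inner_verts (P e))"
        by (auto simp: H_def S_def P f ps inner_verts_endpoints[of a "[]" b, simplified] simp del: One_nat_def)
      have "parcs H = set (vwalk_arcs (a # [] @ [b])) \<union> set (vwalk_arcs (b # xs @ [c])) \<union> set (vwalk_arcs (a # qs @ [c]))"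
        using E unfolding arcs by (simp add: H_def)
      then show "parcs H = (\<Union>e\<in>{(0, 1), (0, 2), (1, 2)}. set (vwalk_arcs (P e)))"
        by (simp only: P UN_insert UN_empty Un_empty_right Un_empty_left Un_ac)
    qed
  qed
  ultimately show ?thesis unfolding contains_induced_subdivision_def by blast
qed

section \<open>Weakest preconditions with running time\<close>

text \<open>Total correctness: a terminating run within the word bound has to exist. The
  postcondition sees the running time, so time bounds are proved along with the result.\<close>

definition wp :: "nat \<Rightarrow> prog \<Rightarrow> (nat \<Rightarrow> state \<Rightarrow> bool) \<Rightarrow> state \<Rightarrow> bool" where
  "wp W c Q s \<longleftrightarrow> (\<exists>t s'. run W c s t s' \<and> Q t s')"

lemma wp_mono: "wp W c Q s \<Longrightarrow> (\<And>t s'. Q t s' \<Longrightarrow> R t s') \<Longrightarrow> wp W c R s"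
  unfolding wp_def by blast

lemma wp_Skip [simp]: "wp W Skip Q s \<longleftrightarrow> Q 1 s"
proof -
  have "run W Skip s t s' \<longleftrightarrow> t = 1 \<and> s' = s" for t s'
    by (subst run.simps) auto
  then show ?thesis unfolding wp_def by simp
qed

lemma wp_Assign [simp]:
  "wp W (Assign r e) Q s \<longleftrightarrow> fits W e s \<and> Q (1 + cost e) (s\<lparr>regs := (regs s)(r := val e s)\<rparr>)"
proof -
  have "run W (Assign r e) s t s' \<longleftrightarrow>
      fits W e s \<and> t = 1 + cost e \<and> s' = s\<lparr>regs := (regs s)(r := val e s)\<rparr>" for t s'
    by (subst run.simps) auto
  then show ?thesis unfolding wp_def by auto
qed

lemma wp_Store [simp]:
  "wp W (Store a i e) Q s \<longleftrightarrow> fits W i s \<and> fits W e s \<and>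
     Q (1 + cost i + cost e) (s\<lparr>arrs := (arrs s)(a := (arrs s a)(val i s := val e s))\<rparr>)"
proof -
  have "run W (Store a i e) s t s' \<longleftrightarrow> fits W i s \<and> fits W e s \<and> t = 1 + cost i + cost e \<and>
      s' = s\<lparr>arrs := (arrs s)(a := (arrs s a)(val i s := val e s))\<rparr>" for t s'
    by (subst run.simps) auto
  then show ?thesis unfolding wp_def by auto
qed

lemma wp_Seq [simp]:
  "wp W (Seq c1 c2) Q s \<longleftrightarrow> wp W c1 (\<lambda>t1. wp W c2 (\<lambda>t2. Q (t1 + t2))) s"
  unfolding wp_def by (blast intro: run.Seq elim: run_SeqE)

lemma wp_Cond [simp]:
  "wp W (Cond e c1 c2) Q s \<longleftrightarrow> fits W e s \<and>
     (if val e s \<noteq> 0 then wp W c1 (\<lambda>t. Q (1 + cost e + t)) s else wp W c2 (\<lambda>t. Q (1 + cost e + t)) s)"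
proof (cases "val e s = 0")
  case True
  then have "run W (Cond e c1 c2) s t s' \<longleftrightarrow> fits W e s \<and> (\<exists>t'. t = 1 + cost e + t' \<and> run W c2 s t' s')" for t s'
    by (subst run.simps) auto
  with True show ?thesis unfolding wp_def by auto
next
  case False
  then have "run W (Cond e c1 c2) s t s' \<longleftrightarrow> fits W e s \<and> (\<exists>t'. t = 1 + cost e + t' \<and> run W c1 s t' s')" for t s'
    by (subst run.simps) auto
  with False show ?thesis unfolding wp_def by auto
qed

text \<open>The measure allows at most \<open>m\<close> rounds; a round costs at most
  \<open>1 + cost e + K\<close>, and the final, failing test adds \<open>1 + cost e\<close>.\<close>

lemma wp_While:
  assumes "I s" "\<mu> s \<le> m"
    and fits: "\<And>s. I s \<Longrightarrow> fits W e s"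
    and body: "\<And>s. I s \<Longrightarrow> val e s \<noteq> 0 \<Longrightarrow> wp W c (\<lambda>t s'. t \<le> K \<and> I s' \<and> \<mu> s' < \<mu> s) s"
  shows "wp W (While e c) (\<lambda>t s'. t \<le> (1 + cost e + K) * m + 1 + cost e \<and> I s' \<and> val e s' = 0) s"
  using assms(1,2)
proof (induction m arbitrary: s)
  case 0
  then have "val e s = 0" using body[of s] unfolding wp_def by fastforce
  with 0 fits show ?case unfolding wp_def by (fastforce intro: run.While_False)
next
  case (Suc m)
  show ?case
  proof (cases "val e s = 0")
    case True
    then have "run W (While e c) s (1 + cost e) s"
      using fits[OF Suc.prems(1)] by (intro run.While_False)
    with True Suc.prems show ?thesis unfolding wp_def by fastforce
  next
    case False
    then obtain t1 s1 where 1: "run W c s t1 s1" "t1 \<le> K" "I s1" "\<mu> s1 < \<mu> s"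
      using body[OF Suc.prems(1)] unfolding wp_def by blast
    then have "\<mu> s1 \<le> m" using Suc.prems(2) by simp
    from Suc.IH[OF 1(3) this] obtain t2 s2
      where 2: "run W (While e c) s1 t2 s2" "t2 \<le> (1 + cost e + K) * m + 1 + cost e" "I s2" "val e s2 = 0"
      unfolding wp_def by blast
    have "run W (While e c) s (1 + cost e + t1 + t2) s2"
      using fits[OF Suc.prems(1)] False 1(1) 2(1) by (rule run.While_True)
    moreover have "1 + cost e + t1 + t2 \<le> (1 + cost e + K) * Suc m + 1 + cost e"
      using 1(2) 2(2) by simp
    ultimately show ?thesis using 2(3,4) unfolding wp_def by blast
  qed
qed

section \<open>Enumerating the induced paths\<close>

text \<open>Keeps the array index 1 from turning into \<open>Suc 0\<close>.\<close>

declare One_nat_def [simp del]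

locale path_search =
  fixes E :: "'a rel" and vs :: "'a list"
  assumes asym_E: "asym E" and distinct_vs: "distinct vs"
begin

abbreviation n where "n \<equiv> length vs"

abbreviation has_cycle where "has_cycle \<equiv> \<exists>a ps qs c. two_block_cycle E a ps qs c"

text \<open>
  The invariants speak about the arrays \<open>A\<close>, the head \<open>h\<close> and the tail \<open>t\<close> of the queue, and the answer \<open>f\<close>.
  The function \<open>p\<close> is a ghost variable: \<open>p a v\<close> is the induced path by which \<open>v\<close> was reached from \<open>a\<close>.
  The layout of the arrays is described with the program below.
\<close>

definition queued :: "(nat \<Rightarrow> nat \<Rightarrow> nat) \<Rightarrow> nat \<Rightarrow> nat \<Rightarrow> nat \<Rightarrow> bool" where
  "queued A k a v \<longleftrightarrow> (\<exists>i<k. A 1 i = a \<and> A 2 i = v)"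

definition blocked :: "(nat \<Rightarrow> nat \<Rightarrow> 'a list) \<Rightarrow> nat \<Rightarrow> nat \<Rightarrow> nat \<Rightarrow> bool" where
  "blocked p a v w \<longleftrightarrow> (\<exists>x\<in>set (butlast (p a v)). adjacent E x (vs ! w))"

definition row_ok :: "(nat \<Rightarrow> nat \<Rightarrow> nat) \<Rightarrow> (nat \<Rightarrow> nat \<Rightarrow> 'a list) \<Rightarrow> nat \<Rightarrow> nat \<Rightarrow> nat \<Rightarrow> bool" where
  "row_ok A p a v w \<longleftrightarrow> A 5 ((a * n + v) * n + w) = of_bool (blocked p a v w)"

text \<open>As long as no cycle is reported, an arc from \<open>v\<close> to \<open>w\<close> must
  show neither configuration: \<open>w\<close> is no common out-neighbour of \<open>a\<close> and
  some \<open>v \<noteq> a\<close>, and an admissible extension to \<open>w\<close> is the recorded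
  one. The entry is \<open>Suc v\<close> because 0 marks an unqueued pair.\<close>

definition arc_ok ::
    "(nat \<Rightarrow> nat \<Rightarrow> nat) \<Rightarrow> nat \<Rightarrow> (nat \<Rightarrow> nat \<Rightarrow> 'a list) \<Rightarrow> nat \<Rightarrow> nat \<Rightarrow> nat \<Rightarrow> bool" where
  "arc_ok A f p a v w \<longleftrightarrow> f \<noteq> 0 \<or> (vs ! v, vs ! w) \<notin> E \<or>
     ((vs ! a, vs ! w) \<in> E \<longrightarrow> a = v) \<and> (\<not> blocked p a v w \<longrightarrow> A 3 (a * n + w) = Suc v)"

text \<open>Holds throughout the search: a queued pair other than a root has its predecessor among
  the first \<open>h\<close> entries, and \<open>p\<close> follows these links. Row
  \<open>(a, a)\<close> of array 5 stays zero, since the path of a root has no earlier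
  vertex.\<close>

definition tree_inv ::
    "(nat \<Rightarrow> nat \<Rightarrow> nat) \<Rightarrow> nat \<Rightarrow> nat \<Rightarrow> nat \<Rightarrow> (nat \<Rightarrow> nat \<Rightarrow> 'a list) \<Rightarrow> bool" where
  "tree_inv A h t f p \<longleftrightarrow>
     (\<forall>i<n. \<forall>j<n. A 0 (i * n + j) = of_bool ((vs ! i, vs ! j) \<in> E)) \<and>
     (\<forall>k<t. A 1 k < n \<and> A 2 k < n) \<and>
     inj_on (\<lambda>k. (A 1 k, A 2 k)) {..<t} \<and>
     (\<forall>a<n. \<forall>v<n. A 3 (a * n + v) \<le> n \<and> (A 3 (a * n + v) = 0 \<longleftrightarrow> \<not> queued A t a v)) \<and>
     (\<forall>a<n. queued A t a a \<and> p a a = [vs ! a] \<and> (\<forall>w<n. A 5 ((a * n + a) * n + w) = 0)) \<and>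
     (\<forall>a v. queued A t a v \<longrightarrow>
        induced_path E (p a v) \<and> hd (p a v) = vs ! a \<and> last (p a v) = vs ! v) \<and>
     (\<forall>a v. queued A t a v \<longrightarrow> a \<noteq> v \<longrightarrow>
        queued A h a (A 3 (a * n + v) - 1) \<and> p a v = p a (A 3 (a * n + v) - 1) @ [vs ! v]) \<and>
     (f \<noteq> 0 \<longrightarrow> has_cycle)"

lemma tree_invD:
  assumes "tree_inv A h t f p"
  shows "i < n \<Longrightarrow> j < n \<Longrightarrow> A 0 (i * n + j) = of_bool ((vs ! i, vs ! j) \<in> E)"
    and "k < t \<Longrightarrow> A 1 k < n" "k < t \<Longrightarrow> A 2 k < n"
    and "inj_on (\<lambda>k. (A 1 k, A 2 k)) {..<t}"
    and "a < n \<Longrightarrow> v < n \<Longrightarrow> A 3 (a * n + v) \<le> n"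
    and "a < n \<Longrightarrow> v < n \<Longrightarrow> A 3 (a * n + v) = 0 \<longleftrightarrow> \<not> queued A t a v"
    and "a < n \<Longrightarrow> queued A t a a" "a < n \<Longrightarrow> p a a = [vs ! a]"
    and "a < n \<Longrightarrow> w < n \<Longrightarrow> A 5 ((a * n + a) * n + w) = 0"
    and "queued A t a v \<Longrightarrow> induced_path E (p a v)" "queued A t a v \<Longrightarrow> hd (p a v) = vs ! a"
    and "queued A t a v \<Longrightarrow> last (p a v) = vs ! v"
    and "queued A t a v \<Longrightarrow> a \<noteq> v \<Longrightarrow> queued A h a (A 3 (a * n + v) - 1)"
    and "queued A t a v \<Longrightarrow> a \<noteq> v \<Longrightarrow> p a v = p a (A 3 (a * n + v) - 1) @ [vs ! v]"
    and "f \<noteq> 0 \<Longrightarrow> has_cycle"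
    and "queued A t a v \<Longrightarrow> a < n" "queued A t a v \<Longrightarrow> v < n"
  using assms by (simp_all add: tree_inv_def) (auto simp: queued_def)

definition outer_inv where
  "outer_inv A h t f p \<longleftrightarrow> tree_inv A h t f p \<and> h \<le> t \<and>
     (\<forall>a v w. queued A h a v \<longrightarrow> w < n \<longrightarrow> row_ok A p a v w \<and> arc_ok A f p a v w)"

text \<open>The pair at position \<open>h\<close> is being expanded, with \<open>w\<close> arcs and
  \<open>r\<close> flags done; \<open>r\<close> is ahead of \<open>w\<close> by one between the
  computation of a flag and the inspection of its arc. The head already counts as
  \<open>Suc h\<close>, since new pairs have this pair as predecessor.\<close>

definition inner_inv where
  "inner_inv A h t f a v u w r p \<longleftrightarrow> tree_inv A (Suc h) t f p \<and> h < t \<and> A 1 h = a \<and> A 2 h = v \<and>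
     (a \<noteq> v \<longrightarrow> A 3 (a * n + v) = Suc u \<and> queued A h a u) \<and>
     (\<forall>a v w. queued A h a v \<longrightarrow> w < n \<longrightarrow> row_ok A p a v w \<and> arc_ok A f p a v w) \<and>
     (\<forall>w'<r. row_ok A p a v w') \<and> (\<forall>w'<w. arc_ok A f p a v w')"

section \<open>Queue membership and row-major indices\<close>

lemma queued_mono: "queued A k a v \<Longrightarrow> k \<le> k' \<Longrightarrow> queued A k' a v"
  unfolding queued_def using less_le_trans by blast

lemma queued_Suc: "queued A (Suc k) a v \<longleftrightarrow> queued A k a v \<or> A 1 k = a \<and> A 2 k = v"
  unfolding queued_def by (auto simp: less_Suc_eq)

lemma index_less: "i < n \<Longrightarrow> j < k \<Longrightarrow> i * k + j < n * k"
proof -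
  assume "i < n" "j < k"
  then have "i * k + j < Suc i * k" by simp
  also have "\<dots> \<le> n * k" using \<open>i < n\<close> by (intro mult_le_mono1) simp
  finally show ?thesis .
qed

lemma index_eq_iff:
  assumes "j < k" "j' < k"
  shows "i * k + j = i' * k + j' \<longleftrightarrow> i = i' \<and> j = (j' :: nat)"
proof
  assume eq: "i * k + j = i' * k + j'"
  have "(i * k + j) div k = i" "(i' * k + j') div k = i'"
    "(i * k + j) mod k = j" "(i' * k + j') mod k = j'"
    using assms by simp_all
  with eq show "i = i' \<and> j = j'" by metis
qed simp

text \<open>The queued pairs are distinct and drawn from an \<open>n\<close> by \<open>n\<close>
  square; this limits the number of expansions.\<close>

lemma tree_inv_queue_bound:
  assumes "tree_inv A h t f p"
  shows "t \<le> n * n"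
proof -
  have "(\<lambda>k. (A 1 k, A 2 k)) ` {..<t} \<subseteq> {..<n} \<times> {..<n}" "inj_on (\<lambda>k. (A 1 k, A 2 k)) {..<t}"
    using assms by (auto simp: tree_inv_def)
  then have "card {..<t} \<le> card ({..<n} \<times> {..<n})" by (intro card_inj_on_le) auto
  then show ?thesis by simp
qed

section \<open>Preservation of the invariant while a pair is expanded\<close>

lemma inner_inv_start:
  assumes "outer_inv A h t f p" "h < t"
  shows "inner_inv A h t f (A 1 h) (A 2 h) (A 3 (A 1 h * n + A 2 h) - 1) 0 0 p"
proof -
  have T: "tree_inv A h t f p" using assms by (simp add: outer_inv_def)
  have q: "queued A t (A 1 h) (A 2 h)" using assms(2) by (auto simp: queued_def)
  then have *: "A 3 (A 1 h * n + A 2 h) \<noteq> 0" using tree_invD(6,16,17)[OF T] by blast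
  have "tree_inv A (Suc h) t f p"
    using T queued_mono[of A h _ _ "Suc h"] by (simp add: tree_inv_def)
  moreover have "queued A h (A 1 h) (A 3 (A 1 h * n + A 2 h) - 1)" if "A 1 h \<noteq> A 2 h"
    using tree_invD(13)[OF T q that] .
  ultimately show ?thesis
    using assms * by (auto simp: inner_inv_def outer_inv_def)
qed

lemma inner_inv_end:
  assumes "inner_inv A h t f a v u n n p"
  shows "outer_inv A (Suc h) t f p"
  using assms unfolding inner_inv_def outer_inv_def by (auto simp: queued_Suc)

lemma inner_invD:
  assumes "inner_inv A h t f a v u w r p"
  shows "a < n" "v < n" "A 3 (a * n + v) \<noteq> 0" "induced_path E (p a v)"
    "hd (p a v) = vs ! a" "last (p a v) = vs ! v" "a \<noteq> v \<Longrightarrow> u < n" "t \<le> n * n"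
    "\<And>i j. i < n \<Longrightarrow> j < n \<Longrightarrow> A 0 (i * n + j) = of_bool ((vs ! i, vs ! j) \<in> E)"
    "\<And>j. j < n \<Longrightarrow> A 3 (a * n + j) \<le> n" "queued A t a v" "tree_inv A (Suc h) t f p"
proof -
  have T: "tree_inv A (Suc h) t f p" and h: "h < t" "A 1 h = a" "A 2 h = v"
    and u: "a \<noteq> v \<longrightarrow> A 3 (a * n + v) = Suc u"
    using assms by (auto simp: inner_inv_def)
  have q: "queued A t a v" using h by (auto simp: queued_def)
  show av: "a < n" "v < n" using tree_invD(16,17)[OF T q] .
  show "A 3 (a * n + v) \<noteq> 0" using tree_invD(6)[OF T av] q by simp
  show "induced_path E (p a v)" "hd (p a v) = vs ! a" "last (p a v) = vs ! v"
    using tree_invD(10-12)[OF T q] .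
  show "a \<noteq> v \<Longrightarrow> u < n" using u tree_invD(5)[OF T av] by auto
  show "t \<le> n * n" using T by (rule tree_inv_queue_bound)
  show "\<And>i j. i < n \<Longrightarrow> j < n \<Longrightarrow> A 0 (i * n + j) = of_bool ((vs ! i, vs ! j) \<in> E)"
    "\<And>j. j < n \<Longrightarrow> A 3 (a * n + j) \<le> n"
    using tree_invD(1,5)[OF T] av by auto
  show "queued A t a v" by (rule q)
  show "tree_inv A (Suc h) t f p" by (rule T)
qed

lemma inner_inv_row_root:
  assumes "inner_inv A h t f a a u w w p" "w < n"
  shows "inner_inv A h t f a a u w (Suc w) p"
proof -
  have "row_ok A p a a w"
    using assms(2) inner_invD(1)[OF assms(1)] tree_invD(8,9)[OF inner_invD(12)[OF assms(1)]]
    by (simp add: row_ok_def blocked_def)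
  then show ?thesis using assms by (auto simp: inner_inv_def less_Suc_eq)
qed

text \<open>\<open>p a v\<close> is \<open>p a u\<close> followed by \<open>vs ! v\<close>, so
  \<open>butlast (p a v)\<close> gains just \<open>vs ! u\<close> over
  \<open>butlast (p a u)\<close>. This recursion makes each flag computable in constant
  time.\<close>

lemma blocked_child:
  assumes "inner_inv A h t f a v u w w p" "a \<noteq> v"
  shows "blocked p a v x \<longleftrightarrow> blocked p a u x \<or> adjacent E (vs ! u) (vs ! x)"
proof -
  note D = inner_invD[OF assms(1)]
  have q: "queued A t a u" using assms by (auto simp: inner_inv_def intro: queued_mono)
  then have "induced_path E (p a u)" "last (p a u) = vs ! u"
    using tree_invD(10,12)[OF D(12)] by blast+
  moreover have "p a v = p a (A 3 (a * n + v) - 1) @ [vs ! v]"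
    using tree_invD(14)[OF D(12,11) assms(2)] .
  then have "p a v = p a u @ [vs ! v]"
    using assms by (auto simp: inner_inv_def)
  ultimately show ?thesis
    by (auto simp: blocked_def induced_path_def set_butlast_last[of "p a u"])
qed

text \<open>\<open>b\<close> evaluates the recursion of \<open>blocked_child\<close>, the sum acting
  as a disjunction of 0/1 values.\<close>

lemma inner_inv_row_child:
  assumes I: "inner_inv A h t f a v u w w p" and "w < n" "a \<noteq> v"
    and b: "b = of_bool (0 < A 5 ((a * n + u) * n + w) + (A 0 (u * n + w) + A 0 (w * n + u)))"
  shows "inner_inv (A(5 := (A 5)((a * n + v) * n + w := b))) h t f a v u w (Suc w) p"
proof -
  define A' where "A' = A(5 := (A 5)((a * n + v) * n + w := b))"
  note D = inner_invD[OF I]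
  have u: "u < n" using D(7) assms by blast
  have other: "A' k = A k" if "k \<noteq> 5" for k using that by (simp add: A'_def)
  have A5: "A' 5 ((a' * n + v') * n + w') = (if a' = a \<and> v' = v \<and> w' = w then b else A 5 ((a' * n + v') * n + w'))"
    if "v' < n" "w' < n" for a' v' w'
    using that D(2) \<open>w < n\<close> by (auto simp: A'_def index_eq_iff)
  have q: "queued A' = queued A" by (simp add: queued_def other fun_eq_iff)
  have ar: "arc_ok A' = arc_ok A" by (simp add: arc_ok_def other fun_eq_iff)
  have T: "tree_inv A (Suc h) t f p" using I by (simp add: inner_inv_def)
  \<comment> \<open>The row of the root \<open>a\<close> must stay zero; \<open>a \<noteq> v\<close>
    keeps the write away from it.\<close>
  have T': "tree_inv A' (Suc h) t f p"
    using T \<open>a \<noteq> v\<close> by (simp add: tree_inv_def q other A5)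
  have "row_ok A p a u w" using I \<open>w < n\<close> \<open>a \<noteq> v\<close> by (auto simp: inner_inv_def)
  then have "b = of_bool (blocked p a v w)"
    using blocked_child[OF I \<open>a \<noteq> v\<close>, of w] D(9) u \<open>w < n\<close> by (auto simp: b row_ok_def)
  then have row: "row_ok A' p a v w" using A5[of v w a] D(2) \<open>w < n\<close> by (simp add: row_ok_def)
  have row': "row_ok A p a' v' w' \<Longrightarrow> row_ok A' p a' v' w'" if "v' < n" "w' < n" for a' v' w'
    using row A5[OF that, of a'] by (auto simp: row_ok_def)
  have qn: "v' < n" if "queued A h a' v'" for a' v'
    using tree_invD(17)[OF T queued_mono[OF that]] I by (simp add: inner_inv_def)
  show ?thesis
    unfolding A'_def[symmetric]
    using I T' row row' qn D(2) \<open>w < n\<close>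
    by (auto simp: inner_inv_def q ar other less_Suc_eq)
qed

lemma inner_inv_advance:
  assumes "inner_inv A h t f a v u w r p" "arc_ok A f p a v w"
  shows "inner_inv A h t f a v u (Suc w) r p"
  using assms by (auto simp: inner_inv_def less_Suc_eq)

text \<open>With a nonzero answer \<open>arc_ok\<close> holds for every arc, so the search simply
  runs on with its invariant intact.\<close>

lemma inner_inv_found:
  assumes "inner_inv A h t f a v u w r p" has_cycle
  shows "inner_inv A h t 1 a v u (Suc w) r p"
  using assms by (auto simp: inner_inv_def tree_inv_def arc_ok_def)

text \<open>The pair \<open>(a, w)\<close> is new, so the paths and predecessor links of the queued
  pairs are unaffected, and the path to \<open>w\<close> is induced since \<open>w\<close> is not
  blocked.\<close>

lemma inner_inv_push:
  assumes I: "inner_inv A h t f a v u w r p" and w: "w < n" "(vs ! v, vs ! w) \<in> E"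
    and shortcut: "(vs ! a, vs ! w) \<in> E \<longrightarrow> a = v" and nb: "\<not> blocked p a v w" and new: "A 3 (a * n + w) = 0"
  shows "inner_inv (A(1 := (A 1)(t := a), 2 := (A 2)(t := w), 3 := (A 3)(a * n + w := Suc v)))
           h (Suc t) f a v u (Suc w) r (p(a := (p a)(w := p a v @ [vs ! w])))"
proof -
  define A' where "A' = A(1 := (A 1)(t := a), 2 := (A 2)(t := w), 3 := (A 3)(a * n + w := Suc v))"
  define p' where "p' = p(a := (p a)(w := p a v @ [vs ! w]))"
  note D = inner_invD[OF I]
  have T: "tree_inv A (Suc h) t f p" and h: "h < t" "A 1 h = a" "A 2 h = v" using I by (auto simp: inner_inv_def)
  have A05: "A' 0 = A 0" "A' 5 = A 5" by (simp_all add: A'_def)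
  have A12: "A' 1 k = A 1 k" "A' 2 k = A 2 k" if "k < t" for k
    using that by (simp_all add: A'_def)
  have A12t: "A' 1 t = a" "A' 2 t = w" by (simp_all add: A'_def)
  have A3: "A' 3 (a' * n + v') = (if a' = a \<and> v' = w then Suc v else A 3 (a' * n + v'))" if "v' < n" for a' v'
    using that w by (auto simp: A'_def index_eq_iff)
  have p': "p' a' v' = (if a' = a \<and> v' = w then p a v @ [vs ! w] else p a' v')" for a' v'
    by (simp add: p'_def)
  have q: "queued A' k a' v' = queued A k a' v'" if "k \<le> t" for k a' v'
    using that A12 by (auto simp: queued_def)
  have qt: "queued A' (Suc t) a' v' \<longleftrightarrow> queued A t a' v' \<or> a' = a \<and> v' = w" for a' v'
    using A12t by (auto simp: queued_Suc q)
  have nq: "\<not> queued A t a w" using tree_invD(6)[OF T D(1) w(1)] new by simp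
  have nqh: "\<not> queued A k a w" if "k \<le> t" for k using nq queued_mono that by blast
  have qn: "a' < n" "v' < n" if "queued A t a' v'" for a' v'
    using tree_invD(16,17)[OF T that] .
  have wa: "w \<noteq> a" using tree_invD(7)[OF T D(1)] nq by auto
  have wv: "w \<noteq> v" using D(3) new by auto
  have irr: "(x, x) \<notin> E" for x using asym_E by (auto dest: asymD)
  have ip: "induced_path E (p a v @ [vs ! w])"
    by (rule induced_path_snoc) (use D w nb irr asymD[OF asym_E w(2)] in \<open>auto simp: blocked_def\<close>)
  have ne: "p a v \<noteq> []" using D(4) by (simp add: induced_path_def)
  have inj: "inj_on (\<lambda>k. (A' 1 k, A' 2 k)) {..<Suc t}"
  proof -
    have "inj_on (\<lambda>k. (A' 1 k, A' 2 k)) {..<t}"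
      using tree_invD(4)[OF T] A12 by (simp add: inj_on_def)
    moreover have "(A' 1 t, A' 2 t) \<notin> (\<lambda>k. (A' 1 k, A' 2 k)) ` {..<t}"
      using nq by (auto simp: A12t A12 queued_def)
    ultimately show ?thesis by (simp add: lessThan_Suc)
  qed
  have T': "tree_inv A' (Suc h) (Suc t) f p'"
    unfolding tree_inv_def
  proof (intro conjI inj)
    show "\<forall>i<n. \<forall>j<n. A' 0 (i * n + j) = of_bool ((vs ! i, vs ! j) \<in> E)"
      using tree_invD(1)[OF T] by (simp add: A05)
    show "\<forall>k<Suc t. A' 1 k < n \<and> A' 2 k < n"
      using tree_invD(2,3)[OF T] A12 A12t D(1) w by (simp add: less_Suc_eq)
    show "\<forall>a<n. \<forall>v<n. A' 3 (a * n + v) \<le> n \<and> (A' 3 (a * n + v) = 0 \<longleftrightarrow> \<not> queued A' (Suc t) a v)"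
      using tree_invD(5,6)[OF T] D(2) by (simp add: A3 qt)
    show "\<forall>a<n. queued A' (Suc t) a a \<and> p' a a = [vs ! a] \<and> (\<forall>w<n. A' 5 ((a * n + a) * n + w) = 0)"
      using tree_invD(7-9)[OF T] wa by (auto simp: qt p' A05)
    show "\<forall>a v. queued A' (Suc t) a v \<longrightarrow>
        induced_path E (p' a v) \<and> hd (p' a v) = vs ! a \<and> last (p' a v) = vs ! v"
      using tree_invD(10-12)[OF T] ip ne D(5) by (simp add: qt p')
    show "f \<noteq> 0 \<longrightarrow> has_cycle" using tree_invD(15)[OF T] by blast
    show "\<forall>a v. queued A' (Suc t) a v \<longrightarrow> a \<noteq> v \<longrightarrow>
        queued A' (Suc h) a (A' 3 (a * n + v) - 1) \<and> p' a v = p' a (A' 3 (a * n + v) - 1) @ [vs ! v]"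
    proof (intro allI impI)
      fix a' v' assume av: "queued A' (Suc t) a' v'" "a' \<noteq> v'"
      show "queued A' (Suc h) a' (A' 3 (a' * n + v') - 1) \<and> p' a' v' = p' a' (A' 3 (a' * n + v') - 1) @ [vs ! v']"
      proof (cases "a' = a \<and> v' = w")
        case True
        then show ?thesis using h w(1) wv A12[OF h(1)] by (simp add: A3 p' q queued_Suc)
      next
        case False
        then have qo: "queued A t a' v'" using av by (auto simp: qt)
        then have eq: "A' 3 (a' * n + v') = A 3 (a' * n + v')" "p' a' v' = p a' v'"
          using qn(2)[OF qo] False by (simp_all only: A3 p' if_False)
        note old = tree_invD(13,14)[OF T qo av(2)]
        \<comment> \<open>The predecessor of an old pair is already queued, so it is not the new
          pair and its path is unchanged.\<close>
        have "\<not> (a' = a \<and> A 3 (a' * n + v') - 1 = w)"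
          using old(1) nqh[of "Suc h"] h by auto
        then show ?thesis using old h by (simp add: eq) (auto simp: p' q)
      qed
    qed
  qed
  have b: "blocked p' a' v' = blocked p a' v'" if "queued A t a' v'" for a' v'
    using that nq by (auto simp: fun_eq_iff blocked_def p')
  have r: "row_ok A' p' a' v' w' = row_ok A p a' v' w'" if "queued A t a' v'" for a' v' w'
    using b[OF that] by (simp add: row_ok_def A05)
  \<comment> \<open>An entry that \<open>arc_ok\<close> requires to be \<open>Suc v'\<close> is
    nonzero, whereas the overwritten entry was zero.\<close>
  have ar: "arc_ok A' f p' a' v' w'" if "arc_ok A f p a' v' w'" "queued A t a' v'" "w' < n" for a' v' w'
    using that b[OF that(2)] new by (auto simp: arc_ok_def A3)
  note D(11)
  moreover have "arc_ok A' f p' a v w"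
    using shortcut w by (auto simp: arc_ok_def A3)
  ultimately have cur: "row_ok A p a v w' \<Longrightarrow> row_ok A' p' a v w'" "w' < Suc w \<Longrightarrow> arc_ok A f p a v w' \<or> w' = w \<Longrightarrow> arc_ok A' f p' a v w'" for w'
    using r ar w by auto
  have qh: "queued A h a' v' \<Longrightarrow> queued A t a' v'" for a' v' using h(1) by (auto intro: queued_mono)
  show ?thesis
    unfolding A'_def[symmetric] p'_def[symmetric] inner_inv_def
  proof (intro conjI T')
    show "h < Suc t" "A' 1 h = a" "A' 2 h = v" using h A12 by auto
    show "a \<noteq> v \<longrightarrow> A' 3 (a * n + v) = Suc u \<and> queued A' h a u"
      using I wv D(2) h by (auto simp: inner_inv_def A3 q)
    show "\<forall>a v w. queued A' h a v \<longrightarrow> w < n \<longrightarrow> row_ok A' p' a v w \<and> arc_ok A' f p' a v w"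
      using I h qh r ar by (auto simp: inner_inv_def q)
    show "\<forall>w'<r. row_ok A' p' a v w'" using I cur(1) by (auto simp: inner_inv_def)
    show "\<forall>w'<Suc w. arc_ok A' f p' a v w'" using I cur(2) by (auto simp: inner_inv_def less_Suc_eq)
  qed
qed

text \<open>The recorded path to \<open>w\<close> and the extension of \<open>p a v\<close> are both
  induced paths from \<open>a\<close> to \<open>w\<close>. They differ because the recorded path is
  the bare root or has another vertex than \<open>vs ! v\<close> before its end.\<close>

lemma inner_inv_second_path:
  assumes I: "inner_inv A h t f a v u w r p" and w: "w < n" "(vs ! v, vs ! w) \<in> E"
    and nb: "\<not> blocked p a v w" and old: "A 3 (a * n + w) \<noteq> 0" "A 3 (a * n + w) \<noteq> Suc v"
  shows has_cycle
proof -
  note D = inner_invD[OF I]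
  have T: "tree_inv A (Suc h) t f p" and h: "h < t" using I by (auto simp: inner_inv_def)
  have irr: "(x, x) \<notin> E" for x using asym_E by (auto dest: asymD)
  have ip: "induced_path E (p a v @ [vs ! w])"
    by (rule induced_path_snoc) (use D w nb irr asymD[OF asym_E w(2)] in \<open>auto simp: blocked_def\<close>)
  have ne: "p a v \<noteq> []" using D(4) by (simp add: induced_path_def)
  have qw: "queued A t a w" using tree_invD(6)[OF T D(1) w(1)] old by simp
  have Q: "induced_path E (p a w)" "hd (p a w) = vs ! a" "last (p a w) = vs ! w"
    using tree_invD(10-12)[OF T qw] .
  have "p a v @ [vs ! w] \<noteq> p a w"
  proof (cases "a = w")
    case True
    then have "p a w = [vs ! a]" using tree_invD(8)[OF T D(1)] by simp
    then show ?thesis using ne by auto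
  next
    case False
    define x where "x = A 3 (a * n + w) - 1"
    have x: "queued A (Suc h) a x" "p a w = p a x @ [vs ! w]"
      using tree_invD(13,14)[OF T qw False] unfolding x_def .
    have qx: "queued A t a x" using x(1) h by (auto intro: queued_mono)
    have xn: "x < n" "last (p a x) = vs ! x" using tree_invD(12,17)[OF T qx] by blast+
    have "x \<noteq> v" using old by (auto simp: x_def)
    then show ?thesis using D(2,6) x(2) xn distinct_vs by (auto simp: nth_eq_iff_index_eq)
  qed
  then show ?thesis
    using two_block_cycle_two_paths[OF asym_E ip Q(1)] Q D(5) ne by simp
qed

lemma inner_inv_shortcut:
  assumes I: "inner_inv A h t f a v u w r p"
    and "(vs ! v, vs ! w) \<in> E" "(vs ! a, vs ! w) \<in> E" "a \<noteq> v"
  shows has_cycle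
proof -
  note D = inner_invD[OF I]
  have "vs ! a \<noteq> vs ! v" using D(1,2) \<open>a \<noteq> v\<close> distinct_vs by (simp add: nth_eq_iff_index_eq)
  then show ?thesis using two_block_cycle_shortcut[OF asym_E D(4), of "vs ! w"] D(5,6) assms by simp
qed

section \<open>Completeness of the enumeration and correctness of a negative answer\<close>

text \<open>With an exhausted queue and answer 0 every queued pair is fully scanned. By induction,
  the last arc of \<open>R\<close> leaves such a pair, and \<open>arc_ok\<close> makes
  \<open>R\<close> the recorded path of its end.\<close>

lemma outer_inv_complete:
  assumes O: "outer_inv A t t 0 p"
    and R: "induced_path E R" "set R \<subseteq> set vs" "hd R = vs ! a" "a < n"
  shows "\<exists>v<n. queued A t a v \<and> p a v = R \<and> last R = vs ! v"
  using R
proof (induction R rule: rev_induct)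
  case Nil
  then show ?case by (simp add: induced_path_def)
next
  case (snoc x R)
  have T: "tree_inv A t t 0 p" using O by (simp add: outer_inv_def)
  show ?case
  proof (cases "R = []")
    case True
    then have "x = vs ! a" using snoc.prems by simp
    then show ?thesis using True tree_invD(7,8)[OF T] snoc.prems(4) by auto
  next
    case False
    have "induced_path E R" using induced_path_segment[of E "[]" R "[x]"] snoc.prems(1) False by simp
    then obtain v where v: "v < n" "queued A t a v" "p a v = R" "last R = vs ! v"
      using snoc False by auto
    obtain w where w: "w < n" "vs ! w = x" using snoc.prems(2) by (auto simp: in_set_conv_nth)
    have "(vs ! v, vs ! w) \<in> E" using induced_path_snocD(1)[OF snoc.prems(1) False] v w by simp
    moreover have "\<not> blocked p a v w"
      using induced_path_snocD(2)[OF snoc.prems(1) False] v w by (auto simp: blocked_def)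
    ultimately have A3: "A 3 (a * n + w) = Suc v"
      using O v(2) w(1) by (auto simp: outer_inv_def arc_ok_def)
    have "a \<noteq> w"
    proof
      assume "a = w"
      then have "x = hd R" using w snoc.prems(3) False by simp
      then show False using snoc.prems(1) False by (simp add: induced_path_def)
    qed
    moreover have "queued A t a w" using tree_invD(6)[OF T snoc.prems(4) w(1)] A3 by simp
    ultimately have "p a w = p a v @ [vs ! w]" "queued A t a w"
      using tree_invD(14)[OF T, of a w] A3 by simp_all
    then show ?thesis using v w by auto
  qed
qed

text \<open>If \<open>qs\<close> is empty, \<open>arc_ok\<close> excludes that \<open>c\<close> is
  an out-neighbour of both \<open>a'\<close> and \<open>last ps\<close>. Otherwise both sides of the
  cycle are the recorded path from \<open>a'\<close> to \<open>c\<close>, hence equal, although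
  their inner vertices are disjoint.\<close>

lemma outer_inv_no_cycle:
  assumes O: "outer_inv A t t 0 p" and V: "E \<subseteq> set vs \<times> set vs"
  shows "\<not> has_cycle"
proof
  assume has_cycle
  then obtain a' ps qs c where tb: "two_block_cycle E a' ps qs c" by blast
  note P = two_block_cycle_paths[OF tb]
  have ne: "ps \<noteq> []" and d: "distinct (a' # ps @ c # qs)" using tb by (auto simp: two_block_cycle_def)
  \<comment> \<open>On a path with at least two vertices, each vertex is an end of an arc and
    therefore listed in \<open>vs\<close>.\<close>
  have path_V: "set R \<subseteq> set vs" if "induced_path E R" "2 \<le> length R" for R
  proof
    fix x assume "x \<in> set R"
    then obtain i where i: "i < length R" "R ! i = x" by (auto simp: in_set_conv_nth)
    have arc: "(R ! j, R ! Suc j) \<in> E" if "Suc j < length R" for j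
    proof -
      have "last (take (Suc j) R) = R ! j" "hd (drop (Suc j) R) = R ! Suc j"
        using that by (simp_all add: take_Suc_conv_app_nth hd_drop_conv_nth)
      then have "(R ! j, R ! Suc j) \<in> set (vwalk_arcs R)"
        using that set_vwalk_arcs_append[of "take (Suc j) R" "drop (Suc j) R"] by auto
      then show ?thesis using \<open>induced_path E R\<close> unfolding induced_path_def by blast
    qed
    show "x \<in> set vs"
    proof (cases "Suc i < length R")
      case True
      then show ?thesis using arc[of i] i V by auto
    next
      case False
      then have "Suc (i - 1) < length R" "Suc (i - 1) = i" using that(2) i by auto
      then show ?thesis using arc[of "i - 1"] i V by auto
    qed
  qed
  have PV: "set (a' # ps) \<subseteq> set vs" by (rule path_V[OF P(1)]) (use ne in \<open>cases ps; simp\<close>)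
  then obtain a where a: "a < n" "vs ! a = a'" by (auto simp: in_set_conv_nth)
  show False
  proof (cases "qs = []")
    case True
    obtain v where v: "v < n" "queued A t a v" "last ps = vs ! v"
      using outer_inv_complete[OF O P(1) PV] a ne by auto
    have "c \<in> set vs" using P(2) V by blast
    then obtain w where w: "w < n" "vs ! w = c" by (auto simp: in_set_conv_nth)
    have "arc_ok A 0 p a v w" using O v w by (auto simp: outer_inv_def)
    then have "a = v" using P(2) P(3)[OF True] v w a by (auto simp: arc_ok_def)
    then have "a' = last ps" using v a by simp
    then show False using d ne by auto
  next
    case False
    obtain v where "v < n" "p a v = a' # ps @ [c]" "c = vs ! v"
      using outer_inv_complete[OF O P(4)[OF False] path_V[OF P(4)[OF False]]] a by auto
    moreover obtain v' where "v' < n" "p a v' = a' # qs @ [c]" "c = vs ! v'"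
      using outer_inv_complete[OF O P(5)[OF False] path_V[OF P(5)[OF False]]] a by auto
    ultimately have "ps = qs" using distinct_vs by (auto simp: nth_eq_iff_index_eq)
    then show False using d ne by (cases ps) auto
  qed
qed

end

section \<open>The program\<close>

context path_search
begin

text \<open>All roots share one queue, which starts with the pairs \<open>(a, a)\<close>. The entry
  \<open>Suc a\<close> of a root marks its pair as queued.\<close>

lemma outer_inv_init:
  assumes "\<forall>i<n. \<forall>j<n. A 0 (i * n + j) = of_bool ((vs ! i, vs ! j) \<in> E)"
    and "\<forall>k<n. A 1 k = k \<and> A 2 k = k"
    and "\<forall>a<n. \<forall>v<n. A 3 (a * n + v) = (if a = v then Suc a else 0)"
    and "\<forall>i. A 5 i = 0"
  shows "outer_inv A 0 n 0 (\<lambda>a v. [vs ! a])"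
proof -
  have q: "queued A n a v \<longleftrightarrow> a < n \<and> a = v" for a v
    using assms(2) by (auto simp: queued_def)
  have irr: "(x, x) \<notin> E" for x using asym_E by (auto dest: asymD)
  have "tree_inv A 0 n 0 (\<lambda>a v. [vs ! a])"
    using assms irr by (auto simp: tree_inv_def q induced_path_def inj_on_def)
  then show ?thesis by (simp add: outer_inv_def queued_def)
qed

end

abbreviation mat :: "nat \<Rightarrow> nat \<Rightarrow> expr" where
  "mat i j \<equiv> Op Add (Op Mul (Reg i) (Reg 0)) (Reg j)"

abbreviation cube :: "nat \<Rightarrow> nat \<Rightarrow> nat \<Rightarrow> expr" where
  "cube i j k \<equiv> Op Add (Op Mul (mat i j) (Reg 0)) (Reg k)"

abbreviation incr :: "nat \<Rightarrow> prog" where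
  "incr r \<equiv> Assign r (Op Add (Reg r) (Const 1))"

text \<open>
  Registers: 0 holds the number of vertices, 1 and 2 the head and the tail of the queue, 3 and 4 the
  current pair \<open>(a, v)\<close>, 5 the predecessor of \<open>v\<close>, 6 the loop variable \<open>w\<close>, 7 the answer.
  Arrays: 1 and 2 hold the queue of pairs, 3 the predecessor plus one (0 if the pair is not yet
  queued), 5 the flags \<open>blocked\<close>.
\<close>

definition row_prog :: prog where
  "row_prog = Cond (Op Equal (Reg 3) (Reg 4)) Skip
     (Store 5 (cube 3 4 6)
       (Op Less (Const 0) (Op Add (Arr 5 (cube 3 5 6)) (Op Add (Arr 0 (mat 5 6)) (Arr 0 (mat 6 5))))))"

definition push_prog :: prog where
  "push_prog = Seq (Store 1 (Reg 2) (Reg 3)) (Seq (Store 2 (Reg 2) (Reg 6))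
     (Seq (Store 3 (mat 3 6) (Op Add (Reg 4) (Const 1))) (incr 2)))"

text \<open>Both sides of the \<open>Less\<close> test are 0 or 1, so it succeeds exactly if
  \<open>a \<noteq> v\<close> and there is an arc from \<open>a\<close> to \<open>w\<close>.\<close>

definition arc_prog :: prog where
  "arc_prog = Cond (Arr 0 (mat 4 6))
     (Cond (Op Less (Op Equal (Reg 3) (Reg 4)) (Arr 0 (mat 3 6))) (Assign 7 (Const 1))
       (Cond (Arr 5 (cube 3 4 6)) Skip
         (Cond (Op Equal (Arr 3 (mat 3 6)) (Const 0)) push_prog
           (Cond (Op Equal (Arr 3 (mat 3 6)) (Op Add (Reg 4) (Const 1))) Skip (Assign 7 (Const 1))))))
     Skip"

definition scan_prog :: prog where
  "scan_prog = While (Op Less (Reg 6) (Reg 0)) (Seq row_prog (Seq arc_prog (incr 6)))"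

definition search_prog :: prog where
  "search_prog = While (Op Less (Reg 1) (Reg 2))
     (Seq (Assign 3 (Arr 1 (Reg 1))) (Seq (Assign 4 (Arr 2 (Reg 1)))
       (Seq (Assign 5 (Op Sub (Arr 3 (mat 3 4)) (Const 1)))
         (Seq (incr 1) (Seq (Assign 6 (Const 0)) scan_prog)))))"

definition init_prog :: prog where
  "init_prog = While (Op Less (Reg 2) (Reg 0))
     (Seq (Store 1 (Reg 2) (Reg 2)) (Seq (Store 2 (Reg 2) (Reg 2))
       (Seq (Store 3 (mat 2 2) (Op Add (Reg 2) (Const 1))) (incr 2))))"

definition TT3_prog :: prog where
  "TT3_prog = Seq init_prog (Seq search_prog (Assign 0 (Reg 7)))"

section \<open>Word bounds and running time\<close>

text \<open>The bounds cover, in turn, the indices of array 5, the incremented tail of the queue,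
  stored predecessors and loop variables, and the sum of three flags.\<close>

locale bounded_path_search = path_search +
  fixes W :: nat
  assumes cube_less_W: "n * n * n < W" and square_less_W: "n * n + 1 < W"
    and Suc_less_W: "n + 1 < W" and three_less_W: "3 < W"
begin

lemma less_W:
  "i < n \<Longrightarrow> i < W" "i < n \<Longrightarrow> i + 1 < W" "i < n \<Longrightarrow> i * n < W" "i < n \<Longrightarrow> j < n \<Longrightarrow> i * n + j < W"
  "i < n \<Longrightarrow> j < n \<Longrightarrow> (i * n + j) * n < W"
  "i < n \<Longrightarrow> j < n \<Longrightarrow> k < n \<Longrightarrow> (i * n + j) * n + k < W" "n < W" "0 < W" "1 < W"
proof -
  show "n < W" "0 < W" "1 < W" using Suc_less_W three_less_W by auto
  show "i < n \<Longrightarrow> i < W" "i < n \<Longrightarrow> i + 1 < W" using Suc_less_W by linarith+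
  show ij: "i < n \<Longrightarrow> j < n \<Longrightarrow> i * n + j < W" for i j
    using index_less[of i j n] square_less_W by linarith
  show "i < n \<Longrightarrow> i * n < W" using ij[of i i] by linarith
  show ijk: "i < n \<Longrightarrow> j < n \<Longrightarrow> k < n \<Longrightarrow> (i * n + j) * n + k < W" for k
  proof -
    assume ijk: "i < n" "j < n" "k < n"
    then have "i * n + j < n * n" by (intro index_less)
    then have "(i * n + j) * n + k < Suc (i * n + j) * n" using ijk by simp
    also have "\<dots> \<le> n * n * n" using \<open>i * n + j < n * n\<close> by (intro mult_le_mono1) simp
    finally show ?thesis using cube_less_W by linarith
  qed
  show "i < n \<Longrightarrow> j < n \<Longrightarrow> (i * n + j) * n < W" using ijk[of j] by linarith
qed

text \<open>The ghost paths are quantified here because they change with each push. The bound on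
  register 7 lets the answer fit into a word.\<close>

definition scan_state :: "nat \<Rightarrow> nat \<Rightarrow> nat \<Rightarrow> nat \<Rightarrow> nat \<Rightarrow> nat \<Rightarrow> state \<Rightarrow> bool" where
  "scan_state h a v u w r s \<longleftrightarrow> regs s 0 = n \<and> regs s 1 = Suc h \<and> regs s 3 = a \<and> regs s 4 = v \<and>
     regs s 5 = u \<and> regs s 6 = w \<and> regs s 7 \<le> 1 \<and>
     (\<exists>p. inner_inv (arrs s) h (regs s 2) (regs s 7) a v u w r p)"

lemma wp_row_prog:
  assumes "scan_state h a v u w w s" "w < n"
  shows "wp W row_prog (\<lambda>t s'. t \<le> 50 \<and> scan_state h a v u w (Suc w) s') s"
proof -
  obtain p where s: "regs s 0 = n" "regs s 1 = Suc h" "regs s 3 = a" "regs s 4 = v" "regs s 5 = u"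
      "regs s 6 = w" "regs s 7 \<le> 1"
    and I: "inner_inv (arrs s) h (regs s 2) (regs s 7) a v u w w p"
    using assms(1) by (auto simp: scan_state_def)
  note D = inner_invD[OF I]
  show ?thesis
  proof (cases "a = v")
    case True
    have "\<exists>p. inner_inv (arrs s) h (regs s 2) (regs s 7) v v u w (Suc w) p"
      using inner_inv_row_root[of "arrs s" h "regs s 2" "regs s 7" v u w p] I \<open>w < n\<close> True by blast
    then show ?thesis using s True less_W(9) less_W(1)[OF D(2)]
      by (simp add: row_prog_def scan_state_def)
  next
    case False
    have u: "u < n" using D(7) False by blast
    have "queued (arrs s) h a u" using I False by (simp add: inner_inv_def)
    then have "row_ok (arrs s) p a u w" using I \<open>w < n\<close> by (simp add: inner_inv_def)
    then have B: "arrs s 5 ((a * n + u) * n + w) \<le> 1" by (simp add: row_ok_def)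
    have M: "arrs s 0 (u * n + w) \<le> 1" "arrs s 0 (w * n + u) \<le> 1" using D(9) u \<open>w < n\<close> by auto
    have fits: "arrs s 5 ((a * n + u) * n + w) + (arrs s 0 (u * n + w) + arrs s 0 (w * n + u)) < W"
      "arrs s 0 (u * n + w) + arrs s 0 (w * n + u) < W"
      "arrs s 5 ((a * n + u) * n + w) < W" "arrs s 0 (u * n + w) < W" "arrs s 0 (w * n + u) < W"
      using B M three_less_W by linarith+
    have "\<exists>p. inner_inv ((arrs s)(5 := (arrs s 5)((a * n + v) * n + w :=
        of_bool (0 < arrs s 5 ((a * n + u) * n + w) + (arrs s 0 (u * n + w) + arrs s 0 (w * n + u))))))
        h (regs s 2) (regs s 7) a v u w (Suc w) p"
      using inner_inv_row_child[OF I \<open>w < n\<close> False refl] by blast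
    then show ?thesis
      using s False u D(1,2) \<open>w < n\<close> fits less_W
      by (simp add: row_prog_def scan_state_def of_bool_def del: add_gr_0)
  qed
qed

text \<open>The cases follow the branches of the program: a missing, blocked or already recorded arc
  advances the scan, a shortcut or a second path reports a cycle, and an unqueued end is
  pushed.\<close>

lemma wp_arc_prog:
  assumes "scan_state h a v u w (Suc w) s" "w < n"
  shows "wp W (Seq arc_prog (incr 6)) (\<lambda>t s'. t \<le> 100 \<and> scan_state h a v u (Suc w) (Suc w) s') s"
proof -
  obtain p where s: "regs s 0 = n" "regs s 1 = Suc h" "regs s 3 = a" "regs s 4 = v" "regs s 5 = u"
      "regs s 6 = w" "regs s 7 \<le> 1"
    and I: "inner_inv (arrs s) h (regs s 2) (regs s 7) a v u w (Suc w) p"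
    using assms(1) by (auto simp: scan_state_def)
  note D = inner_invD[OF I]
  let ?A = "arrs s" and ?f = "regs s 7" and ?t = "regs s 2"
  have M: "?A 0 (v * n + w) = of_bool ((vs ! v, vs ! w) \<in> E)" "?A 0 (a * n + w) = of_bool ((vs ! a, vs ! w) \<in> E)"
    using D(1,2,9) \<open>w < n\<close> by auto
  have B: "?A 5 ((a * n + v) * n + w) = of_bool (blocked p a v w)"
    using I by (simp add: inner_inv_def row_ok_def)
  have A3: "?A 3 (a * n + w) < W" using D(10)[OF \<open>w < n\<close>] Suc_less_W by linarith
  have T: "?t < W" "?t + 1 < W" "w + 1 < W" "Suc v < W"
    using D(2,8) square_less_W Suc_less_W \<open>w < n\<close> by linarith+
  have L: "(if a = v then 1 else 0) < ?A 0 (a * n + w) \<longleftrightarrow> (vs ! a, vs ! w) \<in> E \<and> a \<noteq> v"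
    using M by auto
  note facts = s D(1,2) \<open>w < n\<close> less_W T A3 M(1) B
  have M2: "?A 0 (a * n + w) < W" using M(2) less_W(8,9) by simp
  have adv: "\<exists>p. inner_inv ?A h ?t ?f a v u (Suc w) (Suc w) p" if "arc_ok ?A ?f p a v w"
    using inner_inv_advance[OF I that] by blast
  have found: "\<exists>p. inner_inv ?A h ?t 1 a v u (Suc w) (Suc w) p" if has_cycle
    using inner_inv_found[OF I that] by blast
  show ?thesis
  proof (cases "(vs ! v, vs ! w) \<in> E")
    case False
    then have "arc_ok ?A ?f p a v w" by (simp add: arc_ok_def)
    from adv[OF this] show ?thesis using False
      by (simp add: arc_prog_def scan_state_def facts L M2)
  next
    case arc: True
    show ?thesis
    proof (cases "(vs ! a, vs ! w) \<in> E \<and> a \<noteq> v")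
      case True
      then have has_cycle using inner_inv_shortcut[OF I arc] by blast
      from found[OF this] show ?thesis using True arc
        by (simp add: arc_prog_def scan_state_def facts M(2))
    next
      case nosc: False
      then have L': "\<not> (if a = v then 1 else 0) < ?A 0 (a * n + w)" using L by blast
      show ?thesis
      proof (cases "blocked p a v w")
        case True
        then have "arc_ok ?A ?f p a v w" using nosc by (auto simp: arc_ok_def)
        from adv[OF this] show ?thesis using True arc
          by (simp add: arc_prog_def scan_state_def facts L' M2)
      next
        case nb: False
        consider "?A 3 (a * n + w) = 0" | "?A 3 (a * n + w) = Suc v"
          | "?A 3 (a * n + w) \<noteq> 0" "?A 3 (a * n + w) \<noteq> Suc v" by blast
        then show ?thesis
        proof cases
          case 1
          have "\<exists>p. inner_inv (?A(1 := (?A 1)(?t := a), 2 := (?A 2)(?t := w), 3 := (?A 3)(a * n + w := v + 1)))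
           h (?t + 1) ?f a v u (Suc w) (Suc w) p"
            using inner_inv_push[OF I \<open>w < n\<close> arc _ nb 1] nosc by (simp only: Suc_eq_plus1[symmetric]) blast
          then show ?thesis using 1 arc nb
            by (simp add: arc_prog_def push_prog_def scan_state_def facts L' M2)
        next
          case 2
          then have "arc_ok ?A ?f p a v w" using nosc by (auto simp: arc_ok_def)
          from adv[OF this] show ?thesis using 2 arc nb
            by (simp add: arc_prog_def scan_state_def facts L' M2)
        next
          case 3
          from inner_inv_second_path[OF I \<open>w < n\<close> arc nb 3] have has_cycle .
          from found[OF this] show ?thesis using 3 arc nb
            by (simp add: arc_prog_def scan_state_def facts L' M2)
        qed
      qed
    qed
  qed
qed


lemma wp_scan_prog:
  assumes "scan_state h a v u 0 0 s"
  shows "wp W scan_prog (\<lambda>t s'. t \<le> 154 * n + 4 \<and> scan_state h a v u n n s') s"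
proof -
  let ?I = "\<lambda>s. \<exists>w\<le>n. scan_state h a v u w w s" and ?e = "Op Less (Reg 6) (Reg 0)"
  \<comment> \<open>A round takes at most 50 units for the flag and 100 for the arc with the
    increment; the test adds 4.\<close>
  have "wp W scan_prog (\<lambda>t s'. t \<le> (1 + cost ?e + 150) * n + 1 + cost ?e \<and> ?I s' \<and> val ?e s' = 0) s"
    unfolding scan_prog_def
  proof (rule wp_While[where \<mu> = "\<lambda>s. n - regs s 6"])
    show "?I s" using assms by blast
    show "n - regs s 6 \<le> n" by simp
    show "fits W ?e s" if "?I s" for s
      using that less_W(7-9) by (auto simp: scan_state_def)
    fix s assume "?I s" "val ?e s \<noteq> 0"
    then obtain w where w: "w < n" "scan_state h a v u w w s"
      by (auto simp: scan_state_def split: if_splits)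
    show "wp W (Seq row_prog (Seq arc_prog (incr 6)))
        (\<lambda>t s'. t \<le> 150 \<and> ?I s' \<and> n - regs s' 6 < n - regs s 6) s"
      unfolding wp_Seq[of W row_prog]
    proof (rule wp_mono[OF wp_row_prog[OF w(2,1)]])
      fix t1 :: nat and s1 :: state assume 1: "t1 \<le> 50 \<and> scan_state h a v u w (Suc w) s1"
      show "wp W (Seq arc_prog (incr 6)) (\<lambda>t2 s'. t1 + t2 \<le> 150 \<and> ?I s' \<and> n - regs s' 6 < n - regs s 6) s1"
        by (rule wp_mono[OF wp_arc_prog[OF conjunct2[OF 1] w(1)]])
          (use 1 w in \<open>auto simp: scan_state_def intro!: exI[of _ "Suc w"]\<close>)
    qed
  qed
  then show ?thesis
  proof (rule wp_mono)
    fix t :: nat and s' :: state assume "t \<le> (1 + cost ?e + 150) * n + 1 + cost ?e \<and> ?I s' \<and> val ?e s' = 0"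
    then obtain w where w: "w \<le> n" "scan_state h a v u w w s'" and t: "t \<le> 154 * n + 4"
      and "val ?e s' = 0" by auto
    then have "w = n" by (auto simp: scan_state_def split: if_splits)
    then show "t \<le> 154 * n + 4 \<and> scan_state h a v u n n s'" using w t by simp
  qed
qed

definition search_state :: "state \<Rightarrow> bool" where
  "search_state s \<longleftrightarrow> regs s 0 = n \<and> regs s 7 \<le> 1 \<and> (\<exists>p. outer_inv (arrs s) (regs s 1) (regs s 2) (regs s 7) p)"

text \<open>The head grows in each round and never passes the tail, which is at most
  \<open>n * n\<close>. With linear time per round this gives the cubic bound.\<close>

lemma wp_search_prog:
  assumes "search_state s"
  shows "wp W search_prog (\<lambda>t s'. t \<le> (154 * n + 50) * (n * n) + 4 \<and> search_state s' \<and> regs s' 1 = regs s' 2) s"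
proof -
  let ?e = "Op Less (Reg 1) (Reg 2)"
  have bounds: "regs s 1 \<le> regs s 2" "regs s 2 \<le> n * n" if "search_state s" for s
    using that tree_inv_queue_bound by (auto simp: search_state_def outer_inv_def)
  have "wp W search_prog (\<lambda>t s'. t \<le> (1 + cost ?e + (154 * n + 46)) * (n * n) + 1 + cost ?e \<and>
      search_state s' \<and> val ?e s' = 0) s"
    unfolding search_prog_def
  proof (rule wp_While[where \<mu> = "\<lambda>s. n * n - regs s 1"])
    show "search_state s" by fact
    show "n * n - regs s 1 \<le> n * n" by simp
    show "fits W ?e s" if "search_state s" for s
      using bounds[OF that] square_less_W three_less_W by simp
    fix s assume S: "search_state s" "val ?e s \<noteq> 0"
    then obtain p where O: "outer_inv (arrs s) (regs s 1) (regs s 2) (regs s 7) p"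
      and s: "regs s 0 = n" "regs s 7 \<le> 1" and ht: "regs s 1 < regs s 2"
      by (auto simp: search_state_def split: if_splits)
    note I = inner_inv_start[OF O ht]
    note D = inner_invD[OF I]
    let ?a = "arrs s 1 (regs s 1)" and ?v = "arrs s 2 (regs s 1)"
    let ?x = "arrs s 3 (?a * n + ?v)"
    have W: "regs s 1 < W" "regs s 1 + 1 < W" "?x < W" "?x - 1 < W"
      using bounds[OF S(1)] ht square_less_W Suc_less_W D(10)[OF D(2)] by linarith+
    let ?s = "s\<lparr>regs := (regs s)(3 := ?a, 4 := ?v, 5 := ?x - 1, 1 := regs s 1 + 1, 6 := 0)\<rparr>"
    have "scan_state (regs s 1) ?a ?v (?x - 1) 0 0 ?s"
      using I s by (auto simp: scan_state_def)
    from wp_scan_prog[OF this]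
    have "wp W scan_prog (\<lambda>t s'. t \<le> 154 * n + 4 \<and> search_state s' \<and> regs s' 1 = regs s 1 + 1) ?s"
      by (rule wp_mono) (auto simp: scan_state_def search_state_def dest!: inner_inv_end)
    moreover have "n * n - (regs s 1 + 1) < n * n - regs s 1"
      using bounds[OF S(1)] ht by linarith
    \<comment> \<open>The five assignments before the scan cost 21 of the 46 units, which leaves
      25.\<close>
    ultimately have scan: "wp W scan_prog (\<lambda>t s'. t \<le> 25 + 154 * n \<and> search_state s' \<and> n * n - regs s' 1 < n * n - regs s 1) ?s"
      by (elim wp_mono) auto
    show "wp W (Seq (Assign 3 (Arr 1 (Reg 1))) (Seq (Assign 4 (Arr 2 (Reg 1)))
       (Seq (Assign 5 (Op Sub (Arr 3 (mat 3 4)) (Const 1)))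
         (Seq (incr 1) (Seq (Assign 6 (Const 0)) scan_prog)))))
        (\<lambda>t s'. t \<le> 154 * n + 46 \<and> search_state s' \<and> n * n - regs s' 1 < n * n - regs s 1) s"
      using s W D(1,2) less_W scan by simp
  qed
  then show ?thesis
  proof (rule wp_mono)
    fix t :: nat and s' :: state assume *: "t \<le> (1 + cost ?e + (154 * n + 46)) * (n * n) + 1 + cost ?e \<and> search_state s' \<and> val ?e s' = 0"
    then have "regs s' 1 = regs s' 2" using bounds[of s'] by (auto split: if_splits)
    with * show "t \<le> (154 * n + 50) * (n * n) + 4 \<and> search_state s' \<and> regs s' 1 = regs s' 2"
      by (simp add: algebra_simps)
  qed
qed

lemma wp_init_prog:
  assumes "s = \<lparr> regs = (\<lambda>r. if r = 0 then n else 0),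
     arrs = (\<lambda>a i. if a = 0 \<and> i < n * n \<and> (vs ! (i div n), vs ! (i mod n)) \<in> E then 1 else 0) \<rparr>"
  shows "wp W init_prog (\<lambda>t s'. t \<le> 30 * n + 4 \<and> search_state s') s"
proof -
  let ?e = "Op Less (Reg 2) (Reg 0)"
  let ?I = "\<lambda>s. regs s 0 = n \<and> regs s 1 = 0 \<and> regs s 2 \<le> n \<and> regs s 7 = 0 \<and>
    (\<forall>i<n. \<forall>j<n. arrs s 0 (i * n + j) = of_bool ((vs ! i, vs ! j) \<in> E)) \<and>
    (\<forall>k<regs s 2. arrs s 1 k = k \<and> arrs s 2 k = k) \<and>
    (\<forall>a<n. \<forall>v<n. arrs s 3 (a * n + v) = (if a = v \<and> a < regs s 2 then Suc a else 0)) \<and>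
    (\<forall>i. arrs s 5 i = 0)"
  have "wp W init_prog (\<lambda>t s'. t \<le> (1 + cost ?e + 26) * n + 1 + cost ?e \<and> ?I s' \<and> val ?e s' = 0) s"
    unfolding init_prog_def
  proof (rule wp_While[where \<mu> = "\<lambda>s. n - regs s 2"])
    have "(i * n + j) div n = i" if "j < n" for i j
      using that by (cases "vs = []") auto
    then show "?I s" using index_less[of _ _ n] by (simp add: assms)
    show "n - regs s 2 \<le> n" by simp
    show "fits W ?e s" if "?I s" for s
      using that less_W(7-9) by auto
    fix s assume I: "?I s" and "val ?e s \<noteq> 0"
    then have k: "regs s 2 < n" by (auto split: if_splits)
    show "wp W (Seq (Store 1 (Reg 2) (Reg 2)) (Seq (Store 2 (Reg 2) (Reg 2))
       (Seq (Store 3 (mat 2 2) (Op Add (Reg 2) (Const 1))) (incr 2))))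
       (\<lambda>t s'. t \<le> 26 \<and> ?I s' \<and> n - regs s' 2 < n - regs s 2) s"
      using I k less_W by (auto simp: index_eq_iff less_Suc_eq simp flip: Suc_eq_plus1)
  qed
  then show ?thesis
  proof (rule wp_mono)
    fix t :: nat and s' :: state assume *: "t \<le> (1 + cost ?e + 26) * n + 1 + cost ?e \<and> ?I s' \<and> val ?e s' = 0"
    then have "regs s' 2 = n" by (auto split: if_splits)
    with * have "outer_inv (arrs s') (regs s' 1) (regs s' 2) (regs s' 7) (\<lambda>a v. [vs ! a])"
      using outer_inv_init[of "arrs s'"] by simp
    then show "t \<le> 30 * n + 4 \<and> search_state s'" using * by (auto simp: search_state_def)
  qed
qed

text \<open>A nonzero answer is justified by the invariant, answer 0 by the exhausted queue. The
  constant 10 collects 4 for the last test of each of the two loops and 2 for copying the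
  answer.\<close>

lemma wp_TT3_prog:
  assumes "s = \<lparr> regs = (\<lambda>r. if r = 0 then n else 0),
     arrs = (\<lambda>a i. if a = 0 \<and> i < n * n \<and> (vs ! (i div n), vs ! (i mod n)) \<in> E then 1 else 0) \<rparr>"
    and V: "E \<subseteq> set vs \<times> set vs"
  shows "wp W TT3_prog (\<lambda>t s'. t \<le> 30 * n + (154 * n + 50) * (n * n) + 10 \<and> (regs s' 0 \<noteq> 0 \<longleftrightarrow> has_cycle)) s"
  unfolding TT3_prog_def wp_Seq
proof (rule wp_mono[OF wp_init_prog[OF assms(1)]])
  fix t1 :: nat and s1 :: state assume 1: "t1 \<le> 30 * n + 4 \<and> search_state s1"
  show "wp W search_prog (\<lambda>t2. wp W (Assign 0 (Reg 7)) (\<lambda>t3 s'. t1 + (t2 + t3) \<le> 30 * n + (154 * n + 50) * (n * n) + 10 \<and>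
      (regs s' 0 \<noteq> 0 \<longleftrightarrow> has_cycle))) s1"
  proof (rule wp_mono[OF wp_search_prog[OF conjunct2[OF 1]]])
    fix t2 :: nat and s2 :: state assume 2: "t2 \<le> (154 * n + 50) * (n * n) + 4 \<and> search_state s2 \<and> regs s2 1 = regs s2 2"
    then obtain p where O: "outer_inv (arrs s2) (regs s2 2) (regs s2 2) (regs s2 7) p" and f: "regs s2 7 \<le> 1"
      by (auto simp: search_state_def)
    have "regs s2 7 \<noteq> 0 \<longleftrightarrow> has_cycle"
    proof (cases "regs s2 7 = 0")
      case True
      then show ?thesis using O outer_inv_no_cycle[OF _ V] by simp
    next
      case False
      have "tree_inv (arrs s2) (regs s2 2) (regs s2 2) (regs s2 7) p" using O by (simp add: outer_inv_def)
      from tree_invD(15)[OF this False] False show ?thesis by simp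
    qed
    then show "wp W (Assign 0 (Reg 7)) (\<lambda>t3 s'. t1 + (t2 + t3) \<le> 30 * n + (154 * n + 50) * (n * n) + 10 \<and>
      (regs s' 0 \<noteq> 0 \<longleftrightarrow> has_cycle)) s2"
      using 1 2 f three_less_W by simp
  qed
qed

end

section \<open>Cubic time on oriented graphs\<close>

theorem mainTheorem2:
  shows "solvable_in_time oriented_graph (contains_induced_subdivision TT3) (\<lambda>n. real n ^ 3)"
  unfolding solvable_in_time_def
\<comment> \<open>The word exponent is 3 because the indices of array 5 range up to the cube of the
  number of vertices.\<close>
proof (rule exI[of _ TT3_prog], rule exI[of _ 3],
    rule exI[of _ "\<lambda>n. 30 * n + (154 * n + 50) * (n * n) + 10"], intro conjI allI impI)
  let ?T = "\<lambda>n :: nat. 30 * n + (154 * n + 50) * (n * n) + 10"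
  show "(\<lambda>n. real (?T n)) \<in> O(\<lambda>n. real n ^ 3)"
  \<comment> \<open>244 is the coefficient sum 154 + 50 + 30 + 10; for \<open>n \<ge> 1\<close>
    every monomial is at most the cube.\<close>
  proof (rule bigoI[of _ 244])
    show "\<forall>\<^sub>F n in at_top. norm (real (?T n)) \<le> 244 * norm (real n ^ 3)"
      using eventually_ge_at_top[of 1]
    proof eventually_elim
      case (elim n)
      have "n \<le> n * (n * n)" "n * n \<le> n * (n * n)" using elim by simp_all
      moreover have "?T n = 154 * (n * (n * n)) + 50 * (n * n) + 30 * n + 10"
        by (simp add: algebra_simps)
      ultimately have "?T n \<le> 244 * (n * (n * n))" using elim by linarith
      then have "real (?T n) \<le> real (244 * (n * (n * n)))" by (rule of_nat_mono)
      then show ?case by (simp add: power3_eq_cube mult.assoc)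
    qed
  qed
  fix G :: "nat pair_pre_digraph" and vs
  assume asm: "oriented_graph G \<and> distinct vs \<and> set vs = pverts G"
  then interpret G: pair_digraph G by (simp add: oriented_graph_def)
  let ?n = "length vs"
  have W: "(?n + 2) ^ 3 = ?n * ?n * ?n + 6 * (?n * ?n) + 12 * ?n + 8"
    by (simp add: power3_eq_cube algebra_simps)
  have "?n * ?n * ?n < (?n + 2) ^ 3" "?n * ?n + 1 < (?n + 2) ^ 3" "?n + 1 < (?n + 2) ^ 3" "3 < (?n + 2) ^ 3"
    unfolding W by simp_all
  then interpret bounded_path_search "parcs G" vs "(?n + 2) ^ 3"
    using asm by unfold_locales (auto simp: oriented_graph_def intro: asymI)
  have V: "parcs G \<subseteq> set vs \<times> set vs"
    using asm G.in_arcsD1 G.in_arcsD2 by auto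
  have "has_cycle \<longleftrightarrow> contains_induced_subdivision TT3 G"
    using TT3_induced_subdivision_imp_two_block_cycle two_block_cycle_imp_TT3_induced_subdivision[OF G.pair_digraph]
    by blast
  moreover have "wp ((?n + 2) ^ 3) TT3_prog (\<lambda>t s. t \<le> ?T ?n \<and> (regs s 0 \<noteq> 0 \<longleftrightarrow> has_cycle)) (input_state G vs)"
    by (rule wp_TT3_prog[OF _ V]) (simp add: input_state_def Let_def)
  ultimately show "\<exists>t s. run ((?n + 2) ^ 3) TT3_prog (input_state G vs) t s \<and> t \<le> ?T ?n \<and>
      (regs s 0 \<noteq> 0 \<longleftrightarrow> contains_induced_subdivision TT3 G)"
    unfolding wp_def by simp
qed

end
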